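(* Let $M$ be an open Riemann surface and let $X:M\to\mathbb{R}^3$ be a complete harmonic immersion whose Gaussian image is contained in $\mathbb{S}^2\cap\{x_3>\epsilon\}$ for some $\epsilon>0$. Then $X(M)$ is a plane.
   Context: A harmonic immersion has harmonic coordinates; writing locally $\partial_zX_j=\phi_jdz$, its Gauss map is $\mathfrak{G}=\Im(\phi_2\overline{\phi}_3,\phi_3\overline{\phi}_1,\phi_1\overline{\phi}_2)/\|\cdot\|$ and the Gaussian image is $\mathfrak{G}(M)$. Complete means the induced metric $X^*\langle,\rangle$ is complete. *)

theory Defs
  imports "HOL-Analysis.Analysis"
begin

definition riemann_atlas :: "'a topology \<Rightarrow> ('a set \<times> ('a \<Rightarrow> complex)) set \<Rightarrow> bool" where
  "riemann_atlas T A \<longleftrightarrow>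
     (\<forall>(U,\<phi>)\<in>A. openin T U \<and> open (\<phi> ` U) \<and>
        homeomorphic_map (subtopology T U) (top_of_set (\<phi> ` U)) \<phi>) \<and>
     (\<Union>(U,\<phi>)\<in>A. U) = topspace T \<and>
     (\<forall>(U,\<phi>)\<in>A. \<forall>(V,\<psi>)\<in>A. (\<psi> \<circ> inv_into U \<phi>) holomorphic_on (\<phi> ` (U \<inter> V)))"

definition riemann_surface :: "'a topology \<Rightarrow> ('a set \<times> ('a \<Rightarrow> complex)) set \<Rightarrow> bool" where
  "riemann_surface T A \<longleftrightarrow> topspace T \<noteq> {} \<and> connected_space T \<and> Hausdorff_space T \<and>
     second_countable T \<and> riemann_atlas T A"

definition open_riemann_surface :: "'a topology \<Rightarrow> ('a set \<times> ('a \<Rightarrow> complex)) set \<Rightarrow> bool" where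
  "open_riemann_surface T A \<longleftrightarrow> riemann_surface T A \<and> \<not> compact_space T"

definition harmonic_on :: "complex set \<Rightarrow> (complex \<Rightarrow> 'b::real_normed_vector) \<Rightarrow> bool" where
  "harmonic_on S f \<longleftrightarrow> open S \<and>
     (\<exists>D D2. (\<forall>z\<in>S. (f has_derivative blinfun_apply (D z)) (at z) \<and>
                     (D has_derivative blinfun_apply (D2 z)) (at z)) \<and>
             continuous_on S D2 \<and>
             (\<forall>z\<in>S. blinfun_apply (blinfun_apply (D2 z) 1) 1
                    + blinfun_apply (blinfun_apply (D2 z) \<i>) \<i> = 0))"

definition chart_rep :: "('a \<Rightarrow> real^3) \<Rightarrow> 'a set \<Rightarrow> ('a \<Rightarrow> complex) \<Rightarrow> complex \<Rightarrow> real^3" where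
  "chart_rep X U \<phi> = X \<circ> inv_into U \<phi>"

definition harmonic_immersion ::
  "'a topology \<Rightarrow> ('a set \<times> ('a \<Rightarrow> complex)) set \<Rightarrow> ('a \<Rightarrow> real^3) \<Rightarrow> bool" where
  "harmonic_immersion T A X \<longleftrightarrow>
     continuous_map T euclidean X \<and>
     (\<forall>(U,\<phi>)\<in>A. harmonic_on (\<phi> ` U) (chart_rep X U \<phi>) \<and>
        (\<forall>z\<in>\<phi> ` U. inj (frechet_derivative (chart_rep X U \<phi>) (at z))))"

text \<open>phi_j dz = partial_z X_j, i.e. phi_j = (X_j_x - i X_j_y)/2 in a chart.\<close>
definition phi_comp :: "(complex \<Rightarrow> real^3) \<Rightarrow> 3 \<Rightarrow> complex \<Rightarrow> complex" where
  "phi_comp F j z = Complex (frechet_derivative F (at z) 1 $ j) (- (frechet_derivative F (at z) \<i> $ j)) / 2"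

definition gauss_chart :: "(complex \<Rightarrow> real^3) \<Rightarrow> complex \<Rightarrow> real^3" where
  "gauss_chart F z =
    (let v = vector [Im (phi_comp F 2 z * cnj (phi_comp F 3 z)),
                     Im (phi_comp F 3 z * cnj (phi_comp F 1 z)),
                     Im (phi_comp F 1 z * cnj (phi_comp F 2 z))] :: real^3
     in v /\<^sub>R norm v)"

definition gaussian_image ::
  "('a set \<times> ('a \<Rightarrow> complex)) set \<Rightarrow> ('a \<Rightarrow> real^3) \<Rightarrow> (real^3) set" where
  "gaussian_image A X = (\<Union>(U,\<phi>)\<in>A. gauss_chart (chart_rep X U \<phi>) ` (\<phi> ` U))"

definition curve_length :: "(real \<Rightarrow> 'b::metric_space) \<Rightarrow> ereal" where
  "curve_length g = (SUP (n, t) \<in> {(n::nat, t::nat \<Rightarrow> real). t 0 = 0 \<and> t n = 1 \<and> (\<forall>i<n. t i \<le> t (Suc i))}.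
      ereal (\<Sum>i<n. dist (g (t i)) (g (t (Suc i)))))"

definition induced_dist :: "'a topology \<Rightarrow> ('a \<Rightarrow> real^3) \<Rightarrow> 'a \<Rightarrow> 'a \<Rightarrow> ereal" where
  "induced_dist T X p q =
     (INF \<gamma> \<in> {\<gamma>. pathin T \<gamma> \<and> \<gamma> 0 = p \<and> \<gamma> 1 = q}. curve_length (X \<circ> \<gamma>))"

definition complete_immersion :: "'a topology \<Rightarrow> ('a \<Rightarrow> real^3) \<Rightarrow> bool" where
  "complete_immersion T X \<longleftrightarrow>
     (\<forall>x. (\<forall>i. x i \<in> topspace T) \<and>
          (\<forall>e>0. \<exists>N. \<forall>m\<ge>N. \<forall>n\<ge>N. induced_dist T X (x m) (x n) < ereal e)
        \<longrightarrow> (\<exists>p\<in>topspace T. limitin T x p sequentially))"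

definition is_plane :: "(real^3) set \<Rightarrow> bool" where
  "is_plane P \<longleftrightarrow> (\<exists>n c. n \<noteq> 0 \<and> P = {x. n \<bullet> x = c})"

end

theory Submission
  imports Defs "HOL-Complex_Analysis.Conformal_Mappings"
begin

text \<open>
  A bound on the Gauss map away from the equator makes the holomorphic 1-form
  \<open>\<omega> = (\<phi>\<^sub>1 + \<i> \<phi>\<^sub>2) dz\<close> nowhere vanishing and bounds every \<open>\<phi>\<^sub>j dz\<close> by a constant multiple of
  \<open>\<omega>\<close>. Hence the flat metric given by \<open>\<bar>\<omega>\<bar>\<close> dominates the induced metric up to a constant and is complete,
  so there is a surjective holomorphic map \<open>E\<close> from the complex plane to the surface that pulls \<open>\<omega>\<close> back to
  \<open>dw\<close>. The pullbacks of the \<open>\<phi>\<^sub>j dz\<close> have bounded entire coefficients, hence constant ones, and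
  \<open>X \<circ> E\<close> is real affine.
\<close>

section \<open>Harmonic maps and holomorphic differentials\<close>

text \<open>The form \<open>\<omega>\<close> is the dz-part of d(X_1 + i X_2). Its squared modulus
  is |phi_1|^2 + |phi_2|^2 plus twice Im(phi_1 conj(phi_2)), and that last term is the third entry
  of the unnormalised Gauss vector, positive by hypothesis. The third coefficient comes from the
  orthogonality of the Gauss vector to (phi_1, phi_2, phi_3); solving for it divides by the third
  entry, and this is where a uniform \<epsilon> is needed. The obstacle is that a primitive of
  \<open>\<omega>\<close> may be multivalued on the surface, while its inverse is single valued on
  the plane. So \<open>E\<close> is built as the solution of E^*(\<omega>) = dw by continuation over
  growing concentric discs, where every overlap is convex and uniqueness settles the gluing.
  Completeness acts through its sequential form: images of segments bound the induced distance from
  above, so Cauchy sequences in a parameter disc stay Cauchy on the surface, which yields a uniform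
  step of continuation. Surjectivity is an open-closed argument.\<close>

lemma second_difference_bound:
  fixes F :: "'a::real_normed_vector \<Rightarrow> 'b::real_normed_vector"
    and D :: "'a \<Rightarrow> 'a \<Rightarrow>\<^sub>L 'b"
  assumes F: "\<And>y. norm y < d \<Longrightarrow> (F has_derivative blinfun_apply (D (x + y))) (at (x + y))"
    and D: "\<And>y. norm y < d \<Longrightarrow> norm (D (x + y) - D x - blinfun_apply D2 y) \<le> e * norm y"
    and t: "0 < t" "t * (norm v + norm w) < d" and e: "0 < e"
  shows "norm (F (x + t *\<^sub>R v + t *\<^sub>R w) - F (x + t *\<^sub>R v) - F (x + t *\<^sub>R w) + F x
           - t\<^sup>2 *\<^sub>R blinfun_apply (blinfun_apply D2 w) v) \<le> 2 * e * t\<^sup>2 * (norm v + norm w) * norm v"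
proof -
  \<comment> \<open>Mean value inequality in the direction \<open>v\<close>: the derivative of
    \<open>g\<close> compares two values of \<open>D\<close>, and linearising both at
    \<open>x\<close> needs differentiability of \<open>D\<close> at that one point.\<close>
  define g where "g s = F (x + (s *\<^sub>R v + t *\<^sub>R w)) - F (x + s *\<^sub>R v) - s *\<^sub>R (t *\<^sub>R D2 w v)" for s
  define g' where "g' s h = h *\<^sub>R (D (x + (s *\<^sub>R v + t *\<^sub>R w)) v - D (x + s *\<^sub>R v) v - t *\<^sub>R D2 w v)" for s h
  have nrm: "norm (s *\<^sub>R v + t *\<^sub>R w) \<le> t * (norm v + norm w)" "norm (s *\<^sub>R v) \<le> t * (norm v + norm w)"
    if "s \<in> {0..t}" for s
  proof -
    have a: "norm (s *\<^sub>R v) \<le> t * norm v" using that by (auto intro: mult_right_mono)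
    then show "norm (s *\<^sub>R v) \<le> t * (norm v + norm w)"
      using t by (simp add: algebra_simps add_increasing2)
    show "norm (s *\<^sub>R v + t *\<^sub>R w) \<le> t * (norm v + norm w)"
      using a t norm_triangle_ineq[of "s *\<^sub>R v" "t *\<^sub>R w"] by (simp add: algebra_simps)
  qed
  have der: "(g has_derivative g' s) (at s within {0..t})" if s: "s \<in> {0..t}" for s
  proof -
    have 1: "((\<lambda>s. F (x + (s *\<^sub>R v + t *\<^sub>R w))) has_derivative
        (\<lambda>h. D (x + (s *\<^sub>R v + t *\<^sub>R w)) (h *\<^sub>R v))) (at s within {0..t})"
      by (rule has_derivative_compose[of "\<lambda>s. x + (s *\<^sub>R v + t *\<^sub>R w)" _ _ _ F])
        (use F[of "s *\<^sub>R v + t *\<^sub>R w"] nrm[OF s] t in \<open>auto intro!: derivative_eq_intros\<close>)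
    have 2: "((\<lambda>s. F (x + s *\<^sub>R v)) has_derivative (\<lambda>h. D (x + s *\<^sub>R v) (h *\<^sub>R v))) (at s within {0..t})"
      by (rule has_derivative_compose[of "\<lambda>s. x + s *\<^sub>R v" _ _ _ F])
        (use F[of "s *\<^sub>R v"] nrm[OF s] t in \<open>auto intro!: derivative_eq_intros\<close>)
    show ?thesis unfolding g_def
      by (rule has_derivative_eq_rhs, (rule has_derivative_diff 1 2 derivative_intros)+)
        (auto simp: g'_def fun_eq_iff blinfun.scaleR_right algebra_simps)
  qed
  have bd: "onorm (g' s) \<le> 2 * e * t * (norm v + norm w) * norm v" if s: "s \<in> {0..t}" for s
  proof (rule onorm_bound)
    show "0 \<le> 2 * e * t * (norm v + norm w) * norm v" using e t by simp
    fix h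
    \<comment> \<open>\<open>P\<close> and \<open>Q\<close> are the linearisation errors of
      \<open>D\<close> at the two points; in the difference \<open>D x\<close> cancels.\<close>
    define P where "P = D (x + (s *\<^sub>R v + t *\<^sub>R w)) - D x - D2 (s *\<^sub>R v + t *\<^sub>R w)"
    define Q where "Q = D (x + s *\<^sub>R v) - D x - D2 (s *\<^sub>R v)"
    have P: "norm P \<le> e * (t * (norm v + norm w))"
      unfolding P_def using nrm(1)[OF s] t e
      by (intro order_trans[OF D] mult_left_mono) auto
    have Q: "norm Q \<le> e * (t * (norm v + norm w))"
      unfolding Q_def using nrm(2)[OF s] t e
      by (intro order_trans[OF D] mult_left_mono) auto
    have "D (x + (s *\<^sub>R v + t *\<^sub>R w)) v - D (x + s *\<^sub>R v) v - t *\<^sub>R D2 w v = blinfun_apply (P - Q) v"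
      by (simp add: P_def Q_def blinfun.diff_left blinfun.add_right blinfun.add_left
          blinfun.scaleR_right blinfun.scaleR_left)
    moreover have "norm (blinfun_apply (P - Q) v) \<le> norm (P - Q) * norm v"
      by (rule norm_blinfun)
    moreover have "norm (P - Q) \<le> 2 * e * t * (norm v + norm w)"
      using P Q norm_triangle_ineq4[of P Q] by simp
    then have "norm (P - Q) * norm v \<le> 2 * e * t * (norm v + norm w) * norm v"
      by (rule mult_right_mono) auto
    ultimately have "norm (D (x + (s *\<^sub>R v + t *\<^sub>R w)) v - D (x + s *\<^sub>R v) v - t *\<^sub>R D2 w v)
        \<le> 2 * e * t * (norm v + norm w) * norm v" by (metis order_trans)
    then show "norm (g' s h) \<le> 2 * e * t * (norm v + norm w) * norm v * norm h"
      unfolding g'_def norm_scaleR by (metis abs_ge_zero mult.commute mult_right_mono real_norm_def)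
  qed
  have "norm (g t - g 0) \<le> 2 * e * t * (norm v + norm w) * norm v * norm (t - 0)"
    using t by (intro differentiable_bound[OF _ der bd]) auto
  moreover have "g t - g 0 = F (x + t *\<^sub>R v + t *\<^sub>R w) - F (x + t *\<^sub>R v) - F (x + t *\<^sub>R w) + F x
           - t\<^sup>2 *\<^sub>R D2 w v"
    by (simp add: g_def algebra_simps power2_eq_square)
  ultimately show ?thesis using t by (simp add: power2_eq_square algebra_simps)
qed

text \<open>The second difference of \<open>F\<close> is symmetric in \<open>v\<close> and
  \<open>w\<close>, and both sides approximate it divided by \<open>t\<^sup>2\<close>.\<close>

lemma second_derivative_symmetric:
  fixes F :: "'a::real_normed_vector \<Rightarrow> 'b::real_normed_vector"
    and D :: "'a \<Rightarrow> 'a \<Rightarrow>\<^sub>L 'b"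
  assumes "open S" "x \<in> S"
    and F: "\<And>z. z \<in> S \<Longrightarrow> (F has_derivative blinfun_apply (D z)) (at z)"
    and D: "(D has_derivative blinfun_apply D2) (at x)"
  shows "blinfun_apply (blinfun_apply D2 v) w = blinfun_apply (blinfun_apply D2 w) v"
proof -
  define N where "N = norm v + norm w"
  have le: "norm (D2 w v - D2 v w) \<le> 2 * e * N\<^sup>2" if e: "0 < e" for e
  proof -
    obtain d1 where d1: "d1 > 0" "ball x d1 \<subseteq> S"
      using assms by (meson openE)
    obtain d2 where d2: "d2 > 0"
      "\<And>y. norm (y - x) < d2 \<Longrightarrow> norm (D y - D x - D2 (y - x)) \<le> e * norm (y - x)"
      using D e unfolding has_derivative_at_alt by blast
    define d where "d = min d1 d2"
    have F': "(F has_derivative blinfun_apply (D (x + y))) (at (x + y))" if "norm y < d" for y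
      using that d1 by (intro F) (auto simp: d_def subset_iff dist_norm)
    have D': "norm (D (x + y) - D x - D2 y) \<le> e * norm y" if "norm y < d" for y
      using d2(2)[of "x + y"] that by (simp add: d_def)
    \<comment> \<open>\<open>N + 1\<close> instead of \<open>N\<close> keeps \<open>t\<close>
      positive when \<open>v\<close> and \<open>w\<close> both vanish.\<close>
    define t where "t = d / (2 * (N + 1))"
    have "0 \<le> N" "0 < d" using d1 d2 by (auto simp: N_def d_def)
    then have t: "0 < t" "t * N < d" by (auto simp: t_def field_simps add_nonneg_pos)
    let ?\<Delta> = "F (x + t *\<^sub>R v + t *\<^sub>R w) - F (x + t *\<^sub>R v) - F (x + t *\<^sub>R w) + F x"
    have "norm (?\<Delta> - t\<^sup>2 *\<^sub>R D2 w v) \<le> 2 * e * t\<^sup>2 * N * norm v"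
      unfolding N_def using t by (intro second_difference_bound[OF F' D' _ _ e]) (auto simp: N_def)
    moreover have "norm (?\<Delta> - t\<^sup>2 *\<^sub>R D2 v w) \<le> 2 * e * t\<^sup>2 * N * norm w"
      using second_difference_bound[where v = w and w = v, OF F' D' t(1) _ e] t(2)
      by (simp add: N_def algebra_simps)
    ultimately have "norm ((?\<Delta> - t\<^sup>2 *\<^sub>R D2 v w) - (?\<Delta> - t\<^sup>2 *\<^sub>R D2 w v)) \<le> 2 * e * t\<^sup>2 * N * N"
      by (intro order_trans[OF norm_triangle_ineq4]) (simp add: N_def algebra_simps)
    also have "(?\<Delta> - t\<^sup>2 *\<^sub>R D2 v w) - (?\<Delta> - t\<^sup>2 *\<^sub>R D2 w v) = t\<^sup>2 *\<^sub>R (D2 w v - D2 v w)"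
      by (simp add: algebra_simps)
    finally have "t\<^sup>2 * norm (D2 w v - D2 v w) \<le> t\<^sup>2 * (2 * e * N\<^sup>2)"
      unfolding norm_scaleR by (simp add: power2_eq_square mult_ac)
    then show ?thesis using t by simp
  qed
  have N1: "0 < N\<^sup>2 + 1" by (simp add: add_nonneg_pos)
  have "norm (D2 w v - D2 v w) \<le> 0 + e" if "0 < e" for e
  proof -
    have "norm (D2 w v - D2 v w) \<le> 2 * (e / (2 * (N\<^sup>2 + 1))) * N\<^sup>2"
      using that N1 by (intro le) simp
    also have "\<dots> \<le> 2 * (e / (2 * (N\<^sup>2 + 1))) * (N\<^sup>2 + 1)"
      using that by (intro mult_left_mono) auto
    also have "\<dots> = e" using N1 by (simp add: divide_simps)
    finally show ?thesis by simp
  qed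
  then have "norm (D2 w v - D2 v w) \<le> 0" by (rule field_le_epsilon)
  then show ?thesis by simp
qed

lemma phi_comp_has_derivative:
  assumes "(F has_derivative L) (at z)"
  shows "phi_comp F j z = Complex (L 1 $ j) (- (L \<i> $ j)) / 2"
  using frechet_derivative_at[OF assms] by (simp add: phi_comp_def)

text \<open>For a real function, d X_j = 2 Re(phi_j dz); this is the origin of the factor 2 in later
  formulas.\<close>

lemma has_derivative_nth_eq_phi_comp:
  assumes "(F has_derivative L) (at z)"
  shows "L v $ j = 2 * Re (phi_comp F j z * v)"
proof -
  interpret L: bounded_linear L by (rule has_derivative_bounded_linear[OF assms])
  have "v = Re v *\<^sub>R 1 + Im v *\<^sub>R \<i>" by (simp add: complex_eq_iff)
  then have "L v = Re v *\<^sub>R L 1 + Im v *\<^sub>R L \<i>" by (metis L.add L.scaleR)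
  then show ?thesis by (simp add: phi_comp_has_derivative[OF assms])
qed

text \<open>The chain rule for the (1,0)-form phi_j dz: a holomorphic substitution multiplies its
  coefficient by the complex derivative.\<close>

lemma phi_comp_compose:
  assumes F: "F differentiable at (g z)" and g: "(g has_field_derivative d) (at z)"
  shows "phi_comp (F \<circ> g) j z = phi_comp F j (g z) * d"
proof -
  obtain L where L: "(F has_derivative L) (at (g z))" using F by (auto simp: differentiable_def)
  have "((F \<circ> g) has_derivative (\<lambda>v. L (d * v))) (at z)"
    using diff_chain_at[OF g[unfolded has_field_derivative_def] L] by (simp add: o_def)
  then show ?thesis
    by (subst phi_comp_has_derivative, assumption)
      (simp add: has_derivative_nth_eq_phi_comp[OF L] complex_eq_iff)
qed

lemma harmonic_on_imp_differentiable:
  assumes "harmonic_on S F" "z \<in> S"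
  shows "F differentiable at z"
  using assms by (auto simp: harmonic_on_def differentiable_def)

lemma phi_comp_cong_open:
  assumes "open S" "z \<in> S" "\<And>w. w \<in> S \<Longrightarrow> F w = G w"
  shows "phi_comp F j z = phi_comp G j z"
proof -
  have "(F has_derivative L) (at z) \<longleftrightarrow> (G has_derivative L) (at z)" for L
    using assms has_derivative_transform_within_open by metis
  then have "frechet_derivative F (at z) = frechet_derivative G (at z)"
    by (simp add: frechet_derivative_def)
  then show ?thesis by (simp add: phi_comp_def)
qed

text \<open>The real derivative of the coefficient is complex linear: in the Cauchy-Riemann
  equations, symmetry of the second derivative gives the real part and the Laplace equation the
  imaginary part.\<close>

lemma harmonic_on_imp_phi_comp_holomorphic:
  assumes "harmonic_on S F"
  shows "phi_comp F j holomorphic_on S"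
proof -
  from assms obtain D D2 where S: "open S"
    and F: "\<And>z. z \<in> S \<Longrightarrow> (F has_derivative blinfun_apply (D z)) (at z)"
    and D: "\<And>z. z \<in> S \<Longrightarrow> (D has_derivative blinfun_apply (D2 z)) (at z)"
    and lap: "\<And>z. z \<in> S \<Longrightarrow> D2 z 1 1 + D2 z \<i> \<i> = 0"
    unfolding harmonic_on_def by blast
  have "phi_comp F j field_differentiable at z" if z: "z \<in> S" for z
  proof -
    let ?L = "\<lambda>v. Complex (D2 z v 1 $ j) (- (D2 z v \<i> $ j)) / 2"
    have comp: "((\<lambda>w. D w u $ j) has_derivative (\<lambda>v. D2 z v u $ j)) (at z)" for u
      using bounded_linear.has_derivative[OF bounded_linear_vec_nth
          blinfun.FDERIV[OF D[OF z] has_derivative_const[of u]]]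
      by (simp add: blinfun.zero_right)
    have "((\<lambda>w. (of_real (D w 1 $ j) - \<i> * of_real (D w \<i> $ j)) / 2) has_derivative
        (\<lambda>v. (of_real (D2 z v 1 $ j) - \<i> * of_real (D2 z v \<i> $ j)) / 2)) (at z)"
      by (auto intro!: derivative_eq_intros comp)
    then have der: "((\<lambda>w. Complex (D w 1 $ j) (- (D w \<i> $ j)) / 2) has_derivative ?L) (at z)"
      by (simp add: Complex_eq)
    have sym: "D2 z 1 \<i> = D2 z \<i> 1"
      by (rule second_derivative_symmetric[OF S z F D[OF z]])
    have lap': "D2 z \<i> \<i> $ j = - (D2 z 1 1 $ j)"
      using arg_cong[OF lap[OF z], of "\<lambda>v. v $ j"] by simp
    have "?L v = v * ?L 1" for v
    proof -
      have "v = Re v *\<^sub>R 1 + Im v *\<^sub>R \<i>" by (simp add: complex_eq_iff)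
      then have "D2 z v = Re v *\<^sub>R D2 z 1 + Im v *\<^sub>R D2 z \<i>"
        by (metis blinfun.add_right blinfun.scaleR_right)
      then show ?thesis
        by (simp add: complex_eq_iff blinfun.add_left blinfun.scaleR_left lap' sym)
    qed
    then have "((\<lambda>w. Complex (D w 1 $ j) (- (D w \<i> $ j)) / 2) has_field_derivative ?L 1) (at z)"
      using der unfolding has_field_derivative_def by (metis (no_types, lifting) ext mult.commute)
    then have "(phi_comp F j has_field_derivative ?L 1) (at z)"
      by (rule has_field_derivative_transform_within_open[OF _ S z])
        (simp add: phi_comp_has_derivative[OF F])
    then show ?thesis by (auto simp: field_differentiable_def)
  qed
  then show ?thesis by (simp add: holomorphic_on_def field_differentiable_at_within)
qed

section \<open>The Gauss vector and the flat form\<close>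

text \<open>The three coefficients form, up to sign, the cross product of the real and imaginary
  parts of (a, b, c), hence a vector orthogonal to both.\<close>

lemma im_cross_orthogonal:
  fixes a b c :: complex
  shows "of_real (Im (b * cnj c)) * a + of_real (Im (c * cnj a)) * b + of_real (Im (a * cnj b)) * c = 0"
  by (simp add: complex_eq_iff algebra_simps)

text \<open>The cross term is the third entry of the Gauss vector. It fixes the sign in
  \<open>a + \<i> * b\<close>: with a minus it would be subtracted.\<close>

lemma norm_add_i_times_sq:
  fixes a b :: complex
  shows "(norm (a + \<i> * b))\<^sup>2 = (norm a)\<^sup>2 + (norm b)\<^sup>2 + 2 * Im (a * cnj b)"
  by (simp add: cmod_power2) (simp add: power2_eq_square algebra_simps)

text \<open>The coefficient of \<open>\<omega>\<close>, that is, the z-derivative of the planar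
  projection X_1 + i X_2.\<close>

definition flat_form :: "(complex \<Rightarrow> real^3) \<Rightarrow> complex \<Rightarrow> complex" where
  "flat_form F z = phi_comp F 1 z + \<i> * phi_comp F 2 z"

lemma flat_form_nonzero:
  assumes "0 < Im (phi_comp F 1 z * cnj (phi_comp F 2 z))"
  shows "flat_form F z \<noteq> 0"
proof -
  have "0 < (norm (flat_form F z))\<^sup>2"
    using assms unfolding flat_form_def norm_add_i_times_sq by (simp add: add_nonneg_pos)
  then show ?thesis by auto
qed

lemma gauss_chart_third_pos:
  assumes "0 < gauss_chart F z $ 3"
  shows "0 < Im (phi_comp F 1 z * cnj (phi_comp F 2 z))"
  using assms unfolding gauss_chart_def Let_def
  by (simp add: zero_less_mult_iff)

text \<open>All terms of \<open>norm_add_i_times_sq\<close> are nonnegative, so the first two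
  coefficients are at most \<open>norm (flat_form F z)\<close>. Orthogonality expresses the third
  through them with factors \<open>v $ 1 / v $ 3\<close> and \<open>v $ 2 / v $ 3\<close>, each at
  most \<open>1 / \<epsilon>\<close> in modulus. The sum \<open>1 + 2 / \<epsilon>\<close> serves
  all three.\<close>

lemma norm_phi_comp_le_flat_form:
  assumes "0 < \<epsilon>" "\<epsilon> < gauss_chart F z $ 3"
  shows "norm (phi_comp F j z) \<le> (1 + 2 / \<epsilon>) * norm (flat_form F z)"
proof -
  let ?a = "phi_comp F 1 z" and ?b = "phi_comp F 2 z" and ?c = "phi_comp F 3 z"
  let ?w = "flat_form F z"
  define v :: "real^3" where "v = vector [Im (?b * cnj ?c), Im (?c * cnj ?a), Im (?a * cnj ?b)]"
  have v: "v $ 1 = Im (?b * cnj ?c)" "v $ 2 = Im (?c * cnj ?a)" "v $ 3 = Im (?a * cnj ?b)"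
    by (simp_all add: v_def del: times_complex.simps)
  have g: "\<epsilon> < inverse (norm v) * v $ 3"
    using assms(2) by (simp add: gauss_chart_def Let_def v_def del: times_complex.simps)
  have v3: "0 < v $ 3"
    using gauss_chart_third_pos[of F z] assms unfolding v(3) by linarith
  then have "v \<noteq> 0" by auto
  with g have nv: "\<epsilon> * norm v < v $ 3" by (simp add: field_simps)
  have sq: "(norm ?w)\<^sup>2 = (norm ?a)\<^sup>2 + (norm ?b)\<^sup>2 + 2 * v $ 3"
    unfolding flat_form_def v(3) by (rule norm_add_i_times_sq)
  have "(norm ?a)\<^sup>2 \<le> (norm ?w)\<^sup>2" "(norm ?b)\<^sup>2 \<le> (norm ?w)\<^sup>2"
    using sq v3 zero_le_power2[of "norm ?a"] zero_le_power2[of "norm ?b"] by linarith+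
  then have a: "norm ?a \<le> norm ?w" and b: "norm ?b \<le> norm ?w"
    using power2_le_imp_le norm_ge_zero by blast+
  have "of_real (v $ 1) * ?a + of_real (v $ 2) * ?b + of_real (v $ 3) * ?c = 0"
    unfolding v by (rule im_cross_orthogonal)
  then have "of_real (v $ 3) * ?c = - (of_real (v $ 1) * ?a + of_real (v $ 2) * ?b)"
    by (simp only: eq_neg_iff_add_eq_0 add_ac)
  then have "v $ 3 * norm ?c = norm (of_real (v $ 1) * ?a + of_real (v $ 2) * ?b)"
    using v3 by (metis abs_of_pos norm_minus_cancel norm_mult norm_of_real)
  also have "\<dots> \<le> \<bar>v $ 1\<bar> * norm ?a + \<bar>v $ 2\<bar> * norm ?b"
    by (rule order_trans[OF norm_triangle_ineq]) (simp add: norm_mult)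
  also have "\<dots> \<le> norm v * norm ?w + norm v * norm ?w"
    using a b component_le_norm_cart by (intro add_mono mult_mono) auto
  also have "\<dots> = norm v * (2 * norm ?w)" by simp
  also have "\<dots> \<le> (v $ 3 / \<epsilon>) * (2 * norm ?w)"
    using nv assms(1) by (intro mult_right_mono) (auto simp: field_simps)
  finally have "v $ 3 * norm ?c \<le> v $ 3 * (2 / \<epsilon> * norm ?w)" by simp
  then have c: "norm ?c \<le> 2 / \<epsilon> * norm ?w" using v3 by (rule mult_left_le_imp_le)
  have "0 \<le> 2 / \<epsilon> * norm ?w" using assms(1) by simp
  then have "norm (phi_comp F j z) \<le> norm ?w + 2 / \<epsilon> * norm ?w"
    using exhaust_3[of j] a b c norm_ge_zero[of ?w] by (elim disjE; hypsubst; linarith)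
  then show ?thesis by (simp add: algebra_simps)
qed

lemma flat_form_compose:
  assumes "F differentiable at (g z)" and "(g has_field_derivative d) (at z)"
  shows "flat_form (F \<circ> g) z = flat_form F (g z) * d"
  by (simp add: flat_form_def phi_comp_compose[OF assms] algebra_simps)

text \<open>The cross product of the coefficients is a normal vector. Its third entry is, up to a
  constant, the determinant of the first two coordinates, so these can be prescribed freely.\<close>

lemma is_plane_affine_image:
  fixes c :: "3 \<Rightarrow> complex" and y :: "real^3"
  assumes J: "0 < Im (c 1 * cnj (c 2))"
  shows "is_plane (range (\<lambda>w. y + (\<chi> j. 2 * Re (c j * w))))"
proof -
  define n :: "real^3" where
    "n = vector [Im (c 2 * cnj (c 3)), Im (c 3 * cnj (c 1)), Im (c 1 * cnj (c 2))]"
  have n: "n $ 1 = Im (c 2 * cnj (c 3))" "n $ 2 = Im (c 3 * cnj (c 1))" "n $ 3 = Im (c 1 * cnj (c 2))"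
    by (simp_all add: n_def del: times_complex.simps)
  define L :: "complex \<Rightarrow> real^3" where "L w = (\<chi> j. 2 * Re (c j * w))" for w
  have L: "n \<bullet> L w = 0" for w
  proof -
    have "n \<bullet> L w = 2 * Re ((of_real (n $ 1) * c 1 + of_real (n $ 2) * c 2 + of_real (n $ 3) * c 3) * w)"
      by (simp add: inner_vec_def sum_3 L_def algebra_simps)
    then show ?thesis unfolding n im_cross_orthogonal by simp
  qed
  have "\<exists>w. x = y + L w" if x: "n \<bullet> x = n \<bullet> y" for x
  proof -
    define d where "d = x - y"
    have nd: "n \<bullet> d = 0" using x by (simp add: d_def inner_diff_right)
    define J where "J = Im (c 1 * cnj (c 2))"
    have Jnz: "J \<noteq> 0" using assms by (simp add: J_def)
    \<comment> \<open>Cramer's rule for the first two coordinates\<close>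
    define \<alpha> \<beta> where "\<alpha> = d $ 1 / (2 * J)" and "\<beta> = d $ 2 / (2 * J)"
    define w where "w = \<i> * (of_real \<beta> * cnj (c 1) - of_real \<alpha> * cnj (c 2))"
    have "Re (c 1 * w) = \<alpha> * J" "Re (c 2 * w) = \<beta> * J"
      by (simp_all add: w_def J_def algebra_simps)
    then have 12: "L w $ 1 = d $ 1" "L w $ 2 = d $ 2"
      using Jnz by (simp_all add: L_def \<alpha>_def \<beta>_def del: times_complex.simps)
    \<comment> \<open>Both \<open>L w\<close> and \<open>d\<close> are orthogonal to
      \<open>n\<close> and agree in two coordinates; \<open>n $ 3\<close> is nonzero, so the third
      agrees too.\<close>
    have "n $ 3 * L w $ 3 = n $ 3 * d $ 3"
      using L[of w] nd unfolding inner_vec_def sum_3 inner_real_def 12 by linarith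
    moreover have "n $ 3 \<noteq> 0" using assms unfolding n(3) by linarith
    ultimately have "L w = d" using 12 by (simp add: vec_eq_iff forall_3)
    then show ?thesis by (intro exI[of _ w]) (simp add: d_def)
  qed
  then have "range (\<lambda>w. y + L w) = {x. n \<bullet> x = n \<bullet> y}"
    using L by (auto simp: inner_add_right)
  moreover have "n \<noteq> 0" using assms n(3) by (metis less_irrefl zero_index)
  ultimately show ?thesis unfolding is_plane_def L_def by blast
qed

section \<open>Curve length\<close>

lemma curve_length_le:
  assumes "\<And>s t. 0 \<le> s \<Longrightarrow> s \<le> t \<Longrightarrow> t \<le> 1 \<Longrightarrow> dist (g s) (g t) \<le> L * (t - s)"
  shows "curve_length g \<le> ereal L"
  unfolding curve_length_def
proof (rule SUP_least, clarify)
  fix n :: nat and t :: "nat \<Rightarrow> real"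
  assume t: "t 0 = 0" "t n = 1" "\<forall>i<n. t i \<le> t (Suc i)"
  \<comment> \<open>Places every partition point between \<open>t 0 = 0\<close> and
    \<open>t n = 1\<close>, where the Lipschitz bound is available.\<close>
  have mono: "t i \<le> t j" if "i \<le> j" "j \<le> n" for i j
    using that by (induction j rule: dec_induct) (use t(3) in \<open>auto intro: order_trans\<close>)
  have "(\<Sum>i<n. dist (g (t i)) (g (t (Suc i)))) \<le> (\<Sum>i<n. L * (t (Suc i) - t i))"
  proof (rule sum_mono)
    fix i assume "i \<in> {..<n}"
    then show "dist (g (t i)) (g (t (Suc i))) \<le> L * (t (Suc i) - t i)"
      using mono[of 0 i] mono[of i "Suc i"] mono[of "Suc i" n] t by (intro assms) auto
  qed
  also have "\<dots> = L" by (simp add: sum_lessThan_telescope t flip: sum_distrib_left)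
  finally show "ereal (\<Sum>i<n. dist (g (t i)) (g (t (Suc i)))) \<le> ereal L" by simp
qed

lemma induced_dist_le:
  "pathin T \<gamma> \<Longrightarrow> \<gamma> 0 = p \<Longrightarrow> \<gamma> 1 = q \<Longrightarrow> induced_dist T X p q \<le> curve_length (X \<circ> \<gamma>)"
  unfolding induced_dist_def by (rule INF_lower) simp

section \<open>The flat structure of a surface with tilted Gauss map\<close>

locale tilted_immersion =
  fixes T :: "'a topology" and A :: "('a set \<times> ('a \<Rightarrow> complex)) set"
    and X :: "'a \<Rightarrow> real^3" and \<epsilon> :: real
  assumes surface: "riemann_surface T A"
    and immersion: "harmonic_immersion T A X"
    and eps_pos: "0 < \<epsilon>"
    and gauss: "\<And>x. x \<in> gaussian_image A X \<Longrightarrow> \<epsilon> < x $ 3"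
begin

abbreviation rep :: "'a set \<Rightarrow> ('a \<Rightarrow> complex) \<Rightarrow> complex \<Rightarrow> real^3" where
  "rep U \<phi> \<equiv> chart_rep X U \<phi>"

lemma chart_homeo:
  assumes "(U, \<phi>) \<in> A"
  shows "homeomorphic_map (subtopology T U) (top_of_set (\<phi> ` U)) \<phi>"
  using assms surface by (auto simp: riemann_surface_def riemann_atlas_def)

lemma chart_open:
  assumes "(U, \<phi>) \<in> A"
  shows "openin T U" "open (\<phi> ` U)"
  using assms surface by (auto simp: riemann_surface_def riemann_atlas_def)

lemma chart_subset: "(U, \<phi>) \<in> A \<Longrightarrow> U \<subseteq> topspace T"
  by (meson chart_open(1) openin_subset)

lemma chart_inj: "(U, \<phi>) \<in> A \<Longrightarrow> inj_on \<phi> U"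
  using homeomorphic_imp_injective_map[OF chart_homeo] chart_subset
  by (metis topspace_subtopology_subset)

lemma chart_inv: "(U, \<phi>) \<in> A \<Longrightarrow> p \<in> U \<Longrightarrow> inv_into U \<phi> (\<phi> p) = p"
  by (simp add: chart_inj)

lemma chart_cover:
  assumes "p \<in> topspace T"
  obtains U \<phi> where "(U, \<phi>) \<in> A" "p \<in> U"
proof -
  have "p \<in> (\<Union>(U, \<phi>)\<in>A. U)"
    using assms surface unfolding riemann_surface_def riemann_atlas_def by simp
  then show ?thesis using that by auto
qed

lemma chart_image_open:
  assumes "(U, \<phi>) \<in> A" "openin T W"
  shows "open (\<phi> ` (U \<inter> W))"
proof -
  have "openin (subtopology T U) (U \<inter> W)"
    using assms(2) by (metis inf_commute openin_subtopology_Int)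
  then have "openin (top_of_set (\<phi> ` U)) (\<phi> ` (U \<inter> W))"
    using homeomorphic_imp_open_map[OF chart_homeo[OF assms(1)]] by (simp add: open_map_def)
  then show ?thesis using chart_open(2)[OF assms(1)] openin_open_trans by blast
qed

lemma chart_preimage_open:
  assumes "(U, \<phi>) \<in> A" "open W"
  shows "openin T {q \<in> U. \<phi> q \<in> W}"
proof -
  have "openin (top_of_set (\<phi> ` U)) (\<phi> ` U \<inter> W)"
    using assms(2) by (simp add: openin_open_Int)
  then have "openin (subtopology T U) {q \<in> topspace (subtopology T U). \<phi> q \<in> \<phi> ` U \<inter> W}"
    by (rule openin_continuous_map_preimage[OF homeomorphic_imp_continuous_map[OF chart_homeo[OF assms(1)]]])
  moreover have "{q \<in> topspace (subtopology T U). \<phi> q \<in> \<phi> ` U \<inter> W} = {q \<in> U. \<phi> q \<in> W}"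
    using chart_subset[OF assms(1)] by auto
  ultimately show ?thesis using chart_open(1)[OF assms(1)] openin_trans_full by metis
qed

lemma rep_harmonic: "(U, \<phi>) \<in> A \<Longrightarrow> harmonic_on (\<phi> ` U) (rep U \<phi>)"
  using immersion by (auto simp: harmonic_immersion_def)

lemma rep_differentiable: "(U, \<phi>) \<in> A \<Longrightarrow> p \<in> U \<Longrightarrow> rep U \<phi> differentiable at (\<phi> p)"
  using harmonic_on_imp_differentiable[OF rep_harmonic] by blast

lemma rep_gauss: "(U, \<phi>) \<in> A \<Longrightarrow> p \<in> U \<Longrightarrow> \<epsilon> < gauss_chart (rep U \<phi>) (\<phi> p) $ 3"
  by (rule gauss) (auto simp: gaussian_image_def)

lemma rep_jacobian_pos:
  assumes "(U, \<phi>) \<in> A" "p \<in> U"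
  shows "0 < Im (phi_comp (rep U \<phi>) 1 (\<phi> p) * cnj (phi_comp (rep U \<phi>) 2 (\<phi> p)))"
  by (rule gauss_chart_third_pos) (use rep_gauss[OF assms] eps_pos in linarith)

lemma rep_flat_form_nonzero: "(U, \<phi>) \<in> A \<Longrightarrow> p \<in> U \<Longrightarrow> flat_form (rep U \<phi>) (\<phi> p) \<noteq> 0"
  by (rule flat_form_nonzero[OF rep_jacobian_pos])

lemma rep_phi_comp_holomorphic: "(U, \<phi>) \<in> A \<Longrightarrow> phi_comp (rep U \<phi>) j holomorphic_on \<phi> ` U"
  by (rule harmonic_on_imp_phi_comp_holomorphic[OF rep_harmonic])

lemma rep_flat_form_holomorphic: "(U, \<phi>) \<in> A \<Longrightarrow> flat_form (rep U \<phi>) holomorphic_on \<phi> ` U"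
  unfolding flat_form_def[abs_def] by (intro holomorphic_intros rep_phi_comp_holomorphic)

section \<open>The flat form across charts, and maps that straighten it\<close>

text \<open>This makes the local coefficients \<open>flat_form (rep U \<phi>)\<close> one global
  form on the surface.\<close>

lemma flat_form_transition:
  assumes U: "(U, \<phi>) \<in> A" "p \<in> U" and V: "(V, \<psi>) \<in> A" "p \<in> V"
  obtains d where "((\<psi> \<circ> inv_into U \<phi>) has_field_derivative d) (at (\<phi> p))"
    "flat_form (rep U \<phi>) (\<phi> p) = flat_form (rep V \<psi>) (\<psi> p) * d"
proof -
  let ?\<tau> = "\<psi> \<circ> inv_into U \<phi>"
  have op: "open (\<phi> ` (U \<inter> V))" by (rule chart_image_open[OF U(1) chart_open(1)[OF V(1)]])
  have "?\<tau> holomorphic_on (\<phi> ` (U \<inter> V))"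
    using surface U V by (auto simp: riemann_surface_def riemann_atlas_def)
  then obtain d where d: "(?\<tau> has_field_derivative d) (at (\<phi> p))"
    using holomorphic_on_imp_differentiable_at[OF _ op] U V by (auto simp: field_differentiable_def)
  have \<tau>: "?\<tau> (\<phi> p) = \<psi> p" by (simp add: chart_inv[OF U])
  \<comment> \<open>\<open>X\<close> does not depend on the chart, so near \<open>\<phi> p\<close>
    the two representatives differ by the transition map alone.\<close>
  have eq: "phi_comp (rep U \<phi>) j (\<phi> p) = phi_comp (rep V \<psi> \<circ> ?\<tau>) j (\<phi> p)" for j
    by (rule phi_comp_cong_open[OF op])
      (use U V in \<open>auto simp: chart_rep_def chart_inv[OF U(1)] chart_inv[OF V(1)]\<close>)
  have "flat_form (rep U \<phi>) (\<phi> p) = flat_form (rep V \<psi> \<circ> ?\<tau>) (\<phi> p)"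
    by (simp add: flat_form_def eq)
  also have "\<dots> = flat_form (rep V \<psi>) (\<psi> p) * d"
    using flat_form_compose[where z = "\<phi> p" and g = "?\<tau>" and F = "rep V \<psi>", OF _ d] rep_differentiable[OF V] \<tau> by metis
  finally show ?thesis using d that by blast
qed

text \<open>\<open>E\<close> is holomorphic on \<open>S\<close> and pulls \<open>\<omega>\<close> back to \<open>dw\<close>; its values outside \<open>S\<close> are arbitrary.\<close>

definition flat_map :: "complex set \<Rightarrow> (complex \<Rightarrow> 'a) \<Rightarrow> bool" where
  "flat_map S E \<longleftrightarrow> open S \<and> E ` S \<subseteq> topspace T \<and>
     (\<forall>W. openin T W \<longrightarrow> open {w \<in> S. E w \<in> W}) \<and>
     (\<forall>(U, \<phi>)\<in>A. \<forall>w\<in>S. E w \<in> U \<longrightarrow>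
        ((\<phi> \<circ> E) has_field_derivative inverse (flat_form (rep U \<phi>) (\<phi> (E w)))) (at w))"

lemma flat_mapD:
  assumes "flat_map S E"
  shows "open S" "\<And>w. w \<in> S \<Longrightarrow> E w \<in> topspace T" "\<And>W. openin T W \<Longrightarrow> open {w \<in> S. E w \<in> W}"
    "\<And>U \<phi> w. (U, \<phi>) \<in> A \<Longrightarrow> w \<in> S \<Longrightarrow> E w \<in> U \<Longrightarrow>
       ((\<phi> \<circ> E) has_field_derivative inverse (flat_form (rep U \<phi>) (\<phi> (E w)))) (at w)"
  using assms unfolding flat_map_def by auto

lemma flat_mapI:
  assumes "open S" "\<And>w. w \<in> S \<Longrightarrow> E w \<in> topspace T" "\<And>W. openin T W \<Longrightarrow> open {w \<in> S. E w \<in> W}"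
    "\<And>U \<phi> w. (U, \<phi>) \<in> A \<Longrightarrow> w \<in> S \<Longrightarrow> E w \<in> U \<Longrightarrow>
       ((\<phi> \<circ> E) has_field_derivative inverse (flat_form (rep U \<phi>) (\<phi> (E w)))) (at w)"
  shows "flat_map S E"
  using assms unfolding flat_map_def by auto

text \<open>The defining equation is coordinate free: the factor \<open>d\<close> of the transition
  map turns the reciprocal coefficient of one chart into that of another.\<close>

lemma flat_map_single_chartI:
  assumes S: "open S" and cont: "\<And>W. openin T W \<Longrightarrow> open {w \<in> S. E w \<in> W}"
    and chart: "(U, \<phi>) \<in> A" and ES: "\<And>w. w \<in> S \<Longrightarrow> E w \<in> U"
    and der: "\<And>w. w \<in> S \<Longrightarrow>
      ((\<phi> \<circ> E) has_field_derivative inverse (flat_form (rep U \<phi>) (\<phi> (E w)))) (at w)"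
  shows "flat_map S E"
proof -
  have "((\<psi> \<circ> E) has_field_derivative inverse (flat_form (rep V \<psi>) (\<psi> (E w)))) (at w)"
    if V: "(V, \<psi>) \<in> A" and w: "w \<in> S" "E w \<in> V" for V \<psi> w
  proof -
    obtain d where d: "((\<psi> \<circ> inv_into U \<phi>) has_field_derivative d) (at (\<phi> (E w)))"
      "flat_form (rep U \<phi>) (\<phi> (E w)) = flat_form (rep V \<psi>) (\<psi> (E w)) * d"
      using flat_form_transition[OF chart ES[OF w(1)] V w(2)] by blast
    have "((\<psi> \<circ> inv_into U \<phi> \<circ> (\<phi> \<circ> E)) has_field_derivative
        d * inverse (flat_form (rep U \<phi>) (\<phi> (E w)))) (at w)"
      by (rule DERIV_chain) (use d der[OF w(1)] in auto)
    also have "d * inverse (flat_form (rep U \<phi>) (\<phi> (E w))) = inverse (flat_form (rep V \<psi>) (\<psi> (E w)))"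
      using rep_flat_form_nonzero[OF chart ES[OF w(1)]] d(2) by (auto simp: field_simps)
    finally show ?thesis
      by (rule has_field_derivative_transform_within_open[OF _ cont[OF chart_open(1)[OF V]]])
        (use w ES chart_inv[OF chart] in auto)
  qed
  then show ?thesis
    using S cont chart_subset[OF chart] ES by (intro flat_mapI) auto
qed

lemma flat_map_subset:
  assumes "flat_map S E" "open S'" "S' \<subseteq> S"
  shows "flat_map S' E"
proof -
  have "open {w \<in> S'. E w \<in> W}" if "openin T W" for W
  proof -
    have "{w \<in> S'. E w \<in> W} = S' \<inter> {w \<in> S. E w \<in> W}" using assms(3) by auto
    then show ?thesis using flat_mapD(3)[OF assms(1) that] assms(2) by auto
  qed
  then show ?thesis
    using assms(2) by (intro flat_mapI) (use assms(3) flat_mapD(2,4)[OF assms(1)] in auto)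
qed

text \<open>The form dw is invariant under translation. Solutions can therefore be recentred at any
  parameter value.\<close>

lemma flat_map_shift:
  assumes "flat_map S E"
  shows "flat_map {w. w + a \<in> S} (\<lambda>w. E (w + a))"
proof -
  have vim: "open {w. w + a \<in> N}" if "open N" for N
    using open_vimage[OF that, of "\<lambda>w. w + a"] by (simp add: vimage_def continuous_intros)
  have "((\<phi> \<circ> (\<lambda>w. E (w + a))) has_field_derivative inverse (flat_form (rep U \<phi>) (\<phi> (E (w + a))))) (at w)"
    if "(U, \<phi>) \<in> A" "w + a \<in> S" "E (w + a) \<in> U" for U \<phi> w
    using flat_mapD(4)[OF assms that] by (simp add: DERIV_shift o_def)
  moreover have "open {w \<in> {w. w + a \<in> S}. E (w + a) \<in> W}" if "openin T W" for W
    using vim[OF flat_mapD(3)[OF assms that]] by simp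
  ultimately show ?thesis
    by (intro flat_mapI) (use vim[OF flat_mapD(1)[OF assms]] flat_mapD(2)[OF assms] in auto)
qed

lemma flat_map_locally:
  assumes "\<And>w. w \<in> S \<Longrightarrow> \<exists>N E'. w \<in> N \<and> N \<subseteq> S \<and> (\<forall>z\<in>N. E z = E' z) \<and> flat_map N E'"
  shows "flat_map S E"
proof -
  from assms obtain N E' where N: "\<And>w. w \<in> S \<Longrightarrow> w \<in> N w" "\<And>w. w \<in> S \<Longrightarrow> N w \<subseteq> S"
    "\<And>w z. w \<in> S \<Longrightarrow> z \<in> N w \<Longrightarrow> E z = E' w z" "\<And>w. w \<in> S \<Longrightarrow> flat_map (N w) (E' w)"
    by metis
  have S: "open S"
  proof (subst open_subopen, intro ballI)
    fix w assume w: "w \<in> S"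
    show "\<exists>V. open V \<and> w \<in> V \<and> V \<subseteq> S"
      using N(1,2)[OF w] flat_mapD(1)[OF N(4)[OF w]] by blast
  qed
  have "open {w \<in> S. E w \<in> W}" if W: "openin T W" for W
  proof (subst open_subopen, intro ballI)
    fix w assume w: "w \<in> {w \<in> S. E w \<in> W}"
    then have "open {z \<in> N w. E' w z \<in> W}" using flat_mapD(3)[OF N(4) W] by blast
    moreover have "w \<in> {z \<in> N w. E' w z \<in> W}" using w N(1,3) by auto
    moreover have "{z \<in> N w. E' w z \<in> W} \<subseteq> {w \<in> S. E w \<in> W}"
      using w N(2,3) by auto
    ultimately show "\<exists>V. open V \<and> w \<in> V \<and> V \<subseteq> {w \<in> S. E w \<in> W}" by blast
  qed
  moreover have "((\<phi> \<circ> E) has_field_derivative inverse (flat_form (rep U \<phi>) (\<phi> (E w)))) (at w)"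
    if "(U, \<phi>) \<in> A" "w \<in> S" "E w \<in> U" for U \<phi> w
  proof -
    have "((\<phi> \<circ> E' w) has_field_derivative inverse (flat_form (rep U \<phi>) (\<phi> (E w)))) (at w)"
      using flat_mapD(4)[OF N(4)[OF that(2)] that(1)] N(1,3) that by metis
    then show ?thesis
      by (rule has_field_derivative_transform_within_open[of _ _ _ "N w"])
        (use N(1,3)[OF that(2)] flat_mapD(1)[OF N(4)[OF that(2)]] in auto)
  qed
  moreover have "E w \<in> topspace T" if "w \<in> S" for w
    using N(1,3)[OF that] flat_mapD(2)[OF N(4)[OF that]] by metis
  ultimately show ?thesis using S by (intro flat_mapI)
qed

lemma flat_map_continuous:
  assumes "flat_map S E"
  shows "continuous_map (top_of_set S) T E"
  unfolding continuous_map_def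
proof (intro conjI allI impI)
  show "E \<in> topspace (top_of_set S) \<rightarrow> topspace T" using flat_mapD(2)[OF assms] by auto
  fix W assume "openin T W"
  then have "open {w \<in> S. E w \<in> W}" by (rule flat_mapD(3)[OF assms])
  then show "openin (top_of_set S) {w \<in> topspace (top_of_set S). E w \<in> W}"
    using flat_mapD(1)[OF assms] by (auto simp: openin_open_eq)
qed

section \<open>Local coordinates, uniqueness and local existence\<close>

text \<open>\<open>F\<close> is a primitive of \<open>\<omega>\<close>, available on a disc; since
  its derivative does not vanish, a smaller disc makes it injective.\<close>

lemma flat_coordinate:
  assumes "p \<in> topspace T"
  obtains U \<phi> r F where "(U, \<phi>) \<in> A" "p \<in> U" "0 < r" "ball (\<phi> p) r \<subseteq> \<phi> ` U"
    "\<And>z. z \<in> ball (\<phi> p) r \<Longrightarrow> (F has_field_derivative flat_form (rep U \<phi>) z) (at z)"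
    "inj_on F (ball (\<phi> p) r)"
proof -
  obtain U \<phi> where U: "(U, \<phi>) \<in> A" "p \<in> U" using chart_cover[OF assms] by blast
  obtain s where s: "0 < s" "ball (\<phi> p) s \<subseteq> \<phi> ` U"
    using chart_open(2)[OF U(1)] U(2) open_contains_ball by blast
  have hol: "flat_form (rep U \<phi>) holomorphic_on ball (\<phi> p) s"
    using rep_flat_form_holomorphic[OF U(1)] s(2) holomorphic_on_subset by blast
  obtain F where F: "\<And>z. z \<in> ball (\<phi> p) s \<Longrightarrow>
      (F has_field_derivative flat_form (rep U \<phi>) z) (at z within ball (\<phi> p) s)"
    using holomorphic_convex_primitive'[OF convex_ball open_ball hol] by blast
  have F': "(F has_field_derivative flat_form (rep U \<phi>) z) (at z)" if "z \<in> ball (\<phi> p) s" for z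
    using F[OF that] at_within_open[OF that open_ball] by simp
  have "F holomorphic_on ball (\<phi> p) s" by (rule holomorphic_onI) (use F field_differentiable_def in blast)
  moreover have "deriv F (\<phi> p) \<noteq> 0"
    using DERIV_imp_deriv[OF F'[of "\<phi> p"]] s(1) rep_flat_form_nonzero[OF U] by simp
  ultimately obtain r where r: "0 < r" "ball (\<phi> p) r \<subseteq> ball (\<phi> p) s" "inj_on F (ball (\<phi> p) r)"
    using has_complex_derivative_locally_injective[of F "ball (\<phi> p) s" "\<phi> p"] s(1) by auto
  show ?thesis using that[OF U r(1) _ _ r(3)] r(2) s(2) F' by blast
qed

text \<open>The agreement set is open because flat coordinates turn both maps into translations, and
  its complement is open because the surface is Hausdorff.\<close>

lemma flat_map_unique:
  assumes E1: "flat_map S E1" and E2: "flat_map S E2" and "connected S"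
    and w0: "w0 \<in> S" "E1 w0 = E2 w0" and "w \<in> S"
  shows "E1 w = E2 w"
proof -
  define P where "P = {x \<in> S. E1 x = E2 x}"
  define Q where "Q = {x \<in> S. E1 x \<noteq> E2 x}"
  have "open P"
  proof (subst open_subopen, intro ballI)
    fix x assume "x \<in> P"
    then have x: "x \<in> S" "E1 x = E2 x" by (auto simp: P_def)
    obtain U \<phi> r F where U: "(U, \<phi>) \<in> A" "E1 x \<in> U" and r: "0 < r" "ball (\<phi> (E1 x)) r \<subseteq> \<phi> ` U"
      and F: "\<And>z. z \<in> ball (\<phi> (E1 x)) r \<Longrightarrow> (F has_field_derivative flat_form (rep U \<phi>) z) (at z)"
      and inj: "inj_on F (ball (\<phi> (E1 x)) r)"
      using flat_coordinate[OF flat_mapD(2)[OF E1 x(1)]] by metis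
    define W where "W = {q \<in> U. \<phi> q \<in> ball (\<phi> (E1 x)) r}"
    have W: "openin T W" unfolding W_def by (rule chart_preimage_open[OF U(1) open_ball])
    have "open ({y \<in> S. E1 y \<in> W} \<inter> {y \<in> S. E2 y \<in> W})"
      using flat_mapD(3)[OF E1 W] flat_mapD(3)[OF E2 W] by blast
    moreover have "x \<in> {y \<in> S. E1 y \<in> W} \<inter> {y \<in> S. E2 y \<in> W}"
      using x U r by (auto simp: W_def)
    ultimately obtain d where d: "0 < d" "ball x d \<subseteq> {y \<in> S. E1 y \<in> W} \<inter> {y \<in> S. E2 y \<in> W}"
      using open_contains_ball by blast
    \<comment> \<open>The derivatives of \<open>F\<close> and of \<open>\<phi> \<circ> E\<close> are
      reciprocal, so in the flat coordinate \<open>E\<close> is a translation.\<close>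
    have one: "((\<lambda>y. F (\<phi> (E y))) has_field_derivative 1) (at y)"
      if E: "flat_map S E" and y: "y \<in> S" "E y \<in> W" for E y
    proof -
      have yU: "E y \<in> U" "\<phi> (E y) \<in> ball (\<phi> (E1 x)) r" using y(2) by (auto simp: W_def)
      have "((F \<circ> (\<phi> \<circ> E)) has_field_derivative flat_form (rep U \<phi>) (\<phi> (E y)) *
          inverse (flat_form (rep U \<phi>) (\<phi> (E y)))) (at y)"
        by (rule DERIV_chain) (use F[OF yU(2)] flat_mapD(4)[OF E U(1) y(1) yU(1)] in auto)
      then show ?thesis using rep_flat_form_nonzero[OF U(1) yU(1)] by (simp add: o_def)
    qed
    define h where "h y = F (\<phi> (E1 y)) - F (\<phi> (E2 y))" for y
    have h0: "(h has_derivative (\<lambda>_. 0)) (at y within ball x d)" if "y \<in> ball x d" for y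
    proof -
      have y: "y \<in> S" "E1 y \<in> W" "E2 y \<in> W" using d(2) that by auto
      have "(h has_field_derivative 0) (at y)"
        using DERIV_diff[OF one[OF E1 y(1,2)] one[OF E2 y(1,3)]] by (simp add: h_def[abs_def])
      then have "(h has_derivative (\<lambda>_. 0)) (at y)" by (simp add: has_field_derivative_def lambda_zero)
      then show ?thesis by (rule has_derivative_at_withinI)
    qed
    have "ball x d \<subseteq> P"
    proof
      fix y assume y: "y \<in> ball x d"
      have yS: "y \<in> S" "E1 y \<in> W" "E2 y \<in> W" using d(2) y by auto
      have "h y = h x"
        by (rule has_derivative_zero_unique[OF convex_ball h0 y]) (use d in auto)
      then have "F (\<phi> (E1 y)) = F (\<phi> (E2 y))" by (simp add: h_def x(2))
      then have "\<phi> (E1 y) = \<phi> (E2 y)"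
        using inj yS by (auto simp: W_def dest: inj_onD)
      then have "E1 y = E2 y"
        using chart_inj[OF U(1)] yS by (auto simp: W_def dest: inj_onD)
      then show "y \<in> P" using yS by (simp add: P_def)
    qed
    then show "\<exists>V. open V \<and> x \<in> V \<and> V \<subseteq> P" using d(1) by (metis centre_in_ball open_ball)
  qed
  moreover have "open Q"
  proof (subst open_subopen, intro ballI)
    fix x assume "x \<in> Q"
    then have x: "x \<in> S" "E1 x \<noteq> E2 x" by (auto simp: Q_def)
    have "Hausdorff_space T" using surface by (simp add: riemann_surface_def)
    then obtain W1 W2 where W: "openin T W1" "openin T W2" "E1 x \<in> W1" "E2 x \<in> W2" "disjnt W1 W2"
      using x flat_mapD(2)[OF E1 x(1)] flat_mapD(2)[OF E2 x(1)] unfolding Hausdorff_space_def by metis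
    have "open ({y \<in> S. E1 y \<in> W1} \<inter> {y \<in> S. E2 y \<in> W2})"
      using flat_mapD(3)[OF E1 W(1)] flat_mapD(3)[OF E2 W(2)] by blast
    moreover have "x \<in> {y \<in> S. E1 y \<in> W1} \<inter> {y \<in> S. E2 y \<in> W2}" using x W by auto
    moreover have "{y \<in> S. E1 y \<in> W1} \<inter> {y \<in> S. E2 y \<in> W2} \<subseteq> Q"
      using W(5) by (auto simp: Q_def disjnt_iff)
    ultimately show "\<exists>V. open V \<and> x \<in> V \<and> V \<subseteq> Q" by blast
  qed
  moreover have "P \<inter> Q \<inter> S = {}" "S \<subseteq> P \<union> Q" by (auto simp: P_def Q_def)
  ultimately have "P \<inter> S = {} \<or> Q \<inter> S = {}" using connectedD[OF \<open>connected S\<close>] by blast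
  then show ?thesis using w0 \<open>w \<in> S\<close> by (auto simp: P_def Q_def)
qed

text \<open>\<open>E\<close> inverts the flat coordinate, recentred so that 0 goes to
  \<open>p\<close>. Openness of images is recorded here, where the inverse is explicit, and is
  carried to all solutions by \<open>flat_map_image_open\<close>.\<close>

lemma flat_map_local_existence:
  assumes "p \<in> topspace T"
  obtains \<delta> E where "0 < \<delta>" "flat_map (ball 0 \<delta>) E" "E 0 = p"
    "\<And>S. open S \<Longrightarrow> S \<subseteq> ball 0 \<delta> \<Longrightarrow> openin T (E ` S)"
proof -
  obtain U \<phi> r F where U: "(U, \<phi>) \<in> A" "p \<in> U" and r: "0 < r" "ball (\<phi> p) r \<subseteq> \<phi> ` U"
    and F: "\<And>z. z \<in> ball (\<phi> p) r \<Longrightarrow> (F has_field_derivative flat_form (rep U \<phi>) z) (at z)"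
    and inj: "inj_on F (ball (\<phi> p) r)"
    using flat_coordinate[OF assms] by metis
  let ?B = "ball (\<phi> p) r"
  have holF: "F holomorphic_on ?B"
    using F field_differentiable_at_within field_differentiable_def unfolding holomorphic_on_def by blast
  obtain g where g: "g holomorphic_on (F ` ?B)"
    "\<And>z. z \<in> ?B \<Longrightarrow> deriv F z * deriv g (F z) = 1" "\<And>z. z \<in> ?B \<Longrightarrow> g (F z) = z"
    using holomorphic_has_inverse[OF holF open_ball inj] by metis
  have opF: "open (F ` ?B)" by (rule open_mapping_thm3[OF holF open_ball inj])
  define c where "c = F (\<phi> p)"
  have "c \<in> F ` ?B" using r by (auto simp: c_def)
  then obtain \<delta> where \<delta>: "0 < \<delta>" "ball c \<delta> \<subseteq> F ` ?B" using opF open_contains_ball by blast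
  define G where "G w = g (w + c)" for w
  define E where "E w = inv_into U \<phi> (G w)" for w
  have wc: "w + c \<in> F ` ?B" if "w \<in> ball 0 \<delta>" for w
    using \<delta>(2) that by (auto simp: dist_norm subset_iff)
  have GB: "G w \<in> ?B" "F (G w) = w + c" if w: "w \<in> ball 0 \<delta>" for w
  proof -
    obtain z where z: "z \<in> ?B" "w + c = F z" using wc[OF w] by blast
    have "G w = z" unfolding G_def z(2) by (rule g(3)[OF z(1)])
    then show "G w \<in> ?B" "F (G w) = w + c" using z by auto
  qed
  have EU: "E w \<in> U" "\<phi> (E w) = G w" if "w \<in> ball 0 \<delta>" for w
    unfolding E_def using GB(1)[OF that] r(2) inv_into_into f_inv_into_f by (metis subsetD)+
  have derG: "(G has_field_derivative inverse (flat_form (rep U \<phi>) (G w))) (at w)"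
    if w: "w \<in> ball 0 \<delta>" for w
  proof -
    have "deriv F (G w) * deriv g (w + c) = 1" using g(2)[OF GB(1)[OF w]] GB(2)[OF w] by simp
    then have "deriv g (w + c) = inverse (flat_form (rep U \<phi>) (G w))"
      using DERIV_imp_deriv[OF F[OF GB(1)[OF w]]] by (metis inverse_unique)
    moreover have "(g has_field_derivative deriv g (w + c)) (at (w + c))"
      by (rule holomorphic_derivI[OF g(1) opF wc[OF w]])
    ultimately show ?thesis by (simp add: G_def[abs_def] DERIV_shift)
  qed
  have contG: "continuous_on (ball 0 \<delta>) G"
    using derG by (meson DERIV_isCont continuous_at_imp_continuous_on)
  have "flat_map (ball 0 \<delta>) E"
  proof (rule flat_map_single_chartI[OF open_ball _ U(1) EU(1)])
    fix W assume W: "openin T W"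
    have "{w \<in> ball 0 \<delta>. E w \<in> W} = ball 0 \<delta> \<inter> G -` (\<phi> ` (U \<inter> W))" (is "?L = ?R")
    proof
      show "?L \<subseteq> ?R" using EU by (auto simp flip: EU(2))
      show "?R \<subseteq> ?L" using chart_inv[OF U(1)] by (auto simp: E_def)
    qed
    then show "open {w \<in> ball 0 \<delta>. E w \<in> W}"
      using continuous_open_preimage[OF contG open_ball chart_image_open[OF U(1) W]] by simp
  next
    fix w :: complex assume w: "w \<in> ball 0 \<delta>"
    show "((\<phi> \<circ> E) has_field_derivative inverse (flat_form (rep U \<phi>) (\<phi> (E w)))) (at w)"
      unfolding EU(2)[OF w]
      by (rule has_field_derivative_transform_within_open[OF derG[OF w] open_ball w])
        (simp add: EU(2))
  qed
  moreover have "E 0 = p"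
    using g(3)[of "\<phi> p"] r(1) by (simp add: E_def G_def c_def chart_inv[OF U])
  moreover have "openin T (E ` S)" if S: "open S" "S \<subseteq> ball 0 \<delta>" for S
  proof -
    have opS: "open (?B \<inter> F -` ((\<lambda>w. w + c) ` S))"
      using open_translation[OF S(1), of c]
      by (intro continuous_open_preimage holomorphic_on_imp_continuous_on[OF holF] open_ball)
        (simp add: add.commute)
    have "E ` S = {q \<in> U. \<phi> q \<in> ?B \<inter> F -` ((\<lambda>w. w + c) ` S)}"
    proof (intro set_eqI iffI)
      fix q assume "q \<in> E ` S"
      then obtain w where "w \<in> S" "q = E w" by blast
      then show "q \<in> {q \<in> U. \<phi> q \<in> ?B \<inter> F -` ((\<lambda>w. w + c) ` S)}"
        using EU[of w] GB[of w] S(2) by auto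
    next
      fix q assume "q \<in> {q \<in> U. \<phi> q \<in> ?B \<inter> F -` ((\<lambda>w. w + c) ` S)}"
      then obtain w where w: "q \<in> U" "\<phi> q \<in> ?B" "w \<in> S" "F (\<phi> q) = w + c" by auto
      have "E w = q"
        unfolding E_def G_def using w g(3)[OF w(2)] chart_inv[OF U(1) w(1)] by simp
      then show "q \<in> E ` S" using w(3) by blast
    qed
    then show ?thesis using chart_preimage_open[OF U(1) opS] by simp
  qed
  ultimately show ?thesis using that \<delta>(1) by blast
qed

text \<open>Recentring the solution through \<open>p\<close> at a parameter of norm below half its
  radius still leaves a disc of half the radius.\<close>

lemma flat_map_uniform_local_existence:
  assumes "p \<in> topspace T"
  obtains \<delta> W where "0 < \<delta>" "openin T W" "p \<in> W"
    "\<And>q. q \<in> W \<Longrightarrow> \<exists>E. flat_map (ball 0 \<delta>) E \<and> E 0 = q"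
proof -
  obtain d E where d: "0 < d" and E: "flat_map (ball 0 d) E" "E 0 = p"
    "\<And>S. open S \<Longrightarrow> S \<subseteq> ball 0 d \<Longrightarrow> openin T (E ` S)"
    using flat_map_local_existence[OF assms] by metis
  have "\<exists>E'. flat_map (ball 0 (d/2)) E' \<and> E' 0 = q" if q: "q \<in> E ` ball 0 (d/2)" for q
  proof -
    obtain a where a: "norm a < d/2" "q = E a" using q by auto
    have "ball 0 (d/2) \<subseteq> {w. w + a \<in> ball 0 d}"
      using a(1) by (auto intro!: norm_triangle_lt)
    then have "flat_map (ball 0 (d/2)) (\<lambda>w. E (w + a))"
      by (rule flat_map_subset[OF flat_map_shift[OF E(1)] open_ball])
    then show ?thesis using a(2) by (intro exI[of _ "\<lambda>w. E (w + a)"]) simp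
  qed
  moreover have "openin T (E ` ball 0 (d/2))" using d by (intro E(3)) auto
  moreover have "p \<in> E ` ball 0 (d/2)" using E(2) d by (intro image_eqI[of _ _ 0]) auto
  ultimately show ?thesis using that[of "d/2"] d by auto
qed

text \<open>By uniqueness, a recentred solution coincides near 0 with the local solution of
  \<open>flat_map_local_existence\<close>, whose images are open.\<close>

lemma flat_map_image_open:
  assumes "flat_map S E"
  shows "openin T (E ` S)"
proof (subst openin_subopen, intro ballI)
  fix q assume "q \<in> E ` S"
  then obtain w where w: "w \<in> S" "q = E w" by blast
  obtain d E' where d: "0 < d" and E': "flat_map (ball 0 d) E'" "E' 0 = q"
    "\<And>S. open S \<Longrightarrow> S \<subseteq> ball 0 d \<Longrightarrow> openin T (E' ` S)"
    using flat_map_local_existence[OF flat_mapD(2)[OF assms w(1)]] w(2) by metis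
  obtain e where e: "0 < e" "ball w e \<subseteq> S"
    using flat_mapD(1)[OF assms] w(1) open_contains_ball by blast
  define r where "r = min d e"
  have r: "0 < r" "r \<le> d" using d e by (auto simp: r_def)
  have sub: "ball 0 r \<subseteq> {v. v + w \<in> S}"
    using e(2) by (auto simp: r_def subset_iff dist_norm)
  have 1: "flat_map (ball 0 r) (\<lambda>v. E (v + w))"
    by (rule flat_map_subset[OF flat_map_shift[OF assms] open_ball sub])
  have 2: "flat_map (ball 0 r) E'"
    by (rule flat_map_subset[OF E'(1) open_ball]) (use r in auto)
  have "E' v = E (v + w)" if "v \<in> ball 0 r" for v
    using flat_map_unique[OF 2 1, of 0 v] E'(2) w(2) r that by auto
  then have "E' ` ball 0 r \<subseteq> E ` S" using sub by auto
  moreover have "openin T (E' ` ball 0 r)" using r by (intro E'(3)) auto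
  moreover have "q \<in> E' ` ball 0 r" using E'(2) r by (intro image_eqI[of _ _ 0]) auto
  ultimately show "\<exists>V. openin T V \<and> q \<in> V \<and> V \<subseteq> E ` S" by blast
qed

section \<open>Completeness\<close>

text \<open>In the parameter w the coefficient becomes the quotient of phi_j dz by
  \<open>\<omega>\<close>, a function independent of the chart.\<close>

lemma flat_map_phi_comp:
  assumes E: "flat_map S E" "w \<in> S" and U: "(U, \<phi>) \<in> A" "E w \<in> U"
  shows "(X \<circ> E) differentiable at w"
    "phi_comp (X \<circ> E) j w = phi_comp (rep U \<phi>) j (\<phi> (E w)) / flat_form (rep U \<phi>) (\<phi> (E w))"
proof -
  define N where "N = {v \<in> S. E v \<in> U}"
  have N: "open N" "w \<in> N"
    using flat_mapD(3)[OF E(1) chart_open(1)[OF U(1)]] E U by (auto simp: N_def)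
  have eq: "(rep U \<phi> \<circ> (\<phi> \<circ> E)) v = (X \<circ> E) v" if "v \<in> N" for v
    using that by (simp add: N_def chart_rep_def chart_inv[OF U(1)])
  have der: "((\<phi> \<circ> E) has_field_derivative inverse (flat_form (rep U \<phi>) (\<phi> (E w)))) (at w)"
    by (rule flat_mapD(4)[OF E(1) U(1) E(2) U(2)])
  have dif: "rep U \<phi> differentiable at ((\<phi> \<circ> E) w)" using rep_differentiable[OF U] by simp
  have "(rep U \<phi> \<circ> (\<phi> \<circ> E)) differentiable at w"
    using der dif by (intro differentiable_chain_at) (auto simp: differentiable_def has_field_derivative_def)
  then show "(X \<circ> E) differentiable at w"
    using N eq has_derivative_transform_within_open unfolding differentiable_def by blast
  have "phi_comp (X \<circ> E) j w = phi_comp (rep U \<phi> \<circ> (\<phi> \<circ> E)) j w"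
    by (rule phi_comp_cong_open[OF N]) (rule eq[symmetric])
  also have "\<dots> = phi_comp (rep U \<phi>) j ((\<phi> \<circ> E) w) * inverse (flat_form (rep U \<phi>) (\<phi> (E w)))"
    by (rule phi_comp_compose[OF dif der])
  finally show "phi_comp (X \<circ> E) j w = phi_comp (rep U \<phi>) j (\<phi> (E w)) / flat_form (rep U \<phi>) (\<phi> (E w))"
    by (simp add: divide_inverse)
qed

lemma flat_map_differentiable:
  assumes "flat_map S E" "w \<in> S"
  shows "(X \<circ> E) differentiable at w"
  using chart_cover[OF flat_mapD(2)[OF assms]] flat_map_phi_comp(1)[OF assms] by metis

lemma flat_map_phi_comp_bound:
  assumes "flat_map S E" "w \<in> S"
  shows "norm (phi_comp (X \<circ> E) j w) \<le> 1 + 2 / \<epsilon>"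
proof -
  obtain U \<phi> where U: "(U, \<phi>) \<in> A" "E w \<in> U" using chart_cover[OF flat_mapD(2)[OF assms]] by blast
  have "0 < norm (flat_form (rep U \<phi>) (\<phi> (E w)))" using rep_flat_form_nonzero[OF U] by simp
  then show ?thesis
    using norm_phi_comp_le_flat_form[OF eps_pos rep_gauss[OF U], of j]
    unfolding flat_map_phi_comp(2)[OF assms U] by (simp add: norm_divide pos_divide_le_eq)
qed

text \<open>Dividing both coefficients by the same number scales this quantity by the positive
  inverse square of its norm.\<close>

lemma flat_map_jacobian_pos:
  assumes "flat_map S E" "w \<in> S"
  shows "0 < Im (phi_comp (X \<circ> E) 1 w * cnj (phi_comp (X \<circ> E) 2 w))"
proof -
  obtain U \<phi> where U: "(U, \<phi>) \<in> A" "E w \<in> U" using chart_cover[OF flat_mapD(2)[OF assms]] by blast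
  let ?o = "flat_form (rep U \<phi>) (\<phi> (E w))"
  have "a / ?o * cnj (b / ?o) = (a * cnj b) / of_real ((norm ?o)\<^sup>2)" for a b
    by (simp only: complex_norm_square complex_cnj_divide times_divide_times_eq)
  then have "Im (a / ?o * cnj (b / ?o)) = Im (a * cnj b) / (norm ?o)\<^sup>2" for a b
    by (metis Im_divide_of_real)
  then show ?thesis
    unfolding flat_map_phi_comp(2)[OF assms U]
    using rep_jacobian_pos[OF U] rep_flat_form_nonzero[OF U] by (metis divide_pos_pos zero_less_norm_iff zero_less_power)
qed

lemma flat_map_phi_comp_holomorphic:
  assumes E: "flat_map S E"
  shows "phi_comp (X \<circ> E) j holomorphic_on S"
proof -
  have "phi_comp (X \<circ> E) j field_differentiable at w" if w: "w \<in> S" for w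
  proof -
    obtain U \<phi> where U: "(U, \<phi>) \<in> A" "E w \<in> U" using chart_cover[OF flat_mapD(2)[OF E w]] by blast
    define N where "N = {v \<in> S. E v \<in> U}"
    have N: "open N" "w \<in> N"
      using flat_mapD(3)[OF E chart_open(1)[OF U(1)]] w U by (auto simp: N_def)
    define q where "q z = phi_comp (rep U \<phi>) j z / flat_form (rep U \<phi>) z" for z
    have "q holomorphic_on \<phi> ` U" unfolding q_def[abs_def]
      using rep_flat_form_nonzero[OF U(1)]
      by (intro holomorphic_intros rep_phi_comp_holomorphic[OF U(1)] rep_flat_form_holomorphic[OF U(1)]) auto
    then have "q field_differentiable at ((\<phi> \<circ> E) w)"
      using holomorphic_on_imp_differentiable_at[OF _ chart_open(2)[OF U(1)]] U(2) by auto
    moreover have "(\<phi> \<circ> E) field_differentiable at w"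
      using flat_mapD(4)[OF E U(1) w U(2)] by (auto simp: field_differentiable_def)
    ultimately have "(q \<circ> (\<phi> \<circ> E)) field_differentiable at w"
      by (intro field_differentiable_compose)
    then obtain D where "((q \<circ> (\<phi> \<circ> E)) has_field_derivative D) (at w)"
      by (auto simp: field_differentiable_def)
    then have "(phi_comp (X \<circ> E) j has_field_derivative D) (at w)"
      by (rule has_field_derivative_transform_within_open[OF _ N])
        (use flat_map_phi_comp(2)[OF E _ U(1)] in \<open>auto simp: q_def N_def\<close>)
    then show ?thesis by (auto simp: field_differentiable_def)
  qed
  then show ?thesis by (simp add: holomorphic_on_def field_differentiable_at_within)
qed

text \<open>The 6 is the 2 of d X_j = 2 Re(phi_j dz) times three coordinates, summed in the l1
  norm.\<close>

lemma flat_map_lipschitz: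
  assumes E: "flat_map S E" and "convex S" "a \<in> S" "b \<in> S"
  shows "dist (X (E a)) (X (E b)) \<le> 6 * (1 + 2 / \<epsilon>) * dist a b"
proof -
  let ?K = "1 + 2 / \<epsilon>"
  have K: "0 < ?K" using eps_pos by (simp add: add_pos_pos)
  let ?D = "\<lambda>w. frechet_derivative (X \<circ> E) (at w)"
  have der: "((X \<circ> E) has_derivative ?D w) (at w)" if "w \<in> S" for w
    using flat_map_differentiable[OF E that] frechet_derivative_works by blast
  have bound: "onorm (?D w) \<le> 6 * ?K" if w: "w \<in> S" for w
  proof (rule onorm_bound)
    show "0 \<le> 6 * ?K" using K by simp
    fix v
    have "\<bar>?D w v $ j\<bar> \<le> 2 * ?K * norm v" for j
    proof -
      have "\<bar>?D w v $ j\<bar> = 2 * \<bar>Re (phi_comp (X \<circ> E) j w * v)\<bar>"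
        unfolding has_derivative_nth_eq_phi_comp[OF der[OF w]] abs_mult by simp
      also have "\<dots> \<le> 2 * norm (phi_comp (X \<circ> E) j w * v)"
        by (intro mult_left_mono abs_Re_le_cmod) simp
      also have "\<dots> \<le> 2 * (?K * norm v)"
        unfolding norm_mult using flat_map_phi_comp_bound[OF E w]
        by (intro mult_left_mono mult_right_mono) auto
      finally show ?thesis by (simp only: mult.assoc)
    qed
    then have "(\<Sum>j\<in>UNIV. \<bar>?D w v $ j\<bar>) \<le> (\<Sum>j\<in>(UNIV :: 3 set). 2 * ?K * norm v)"
      by (intro sum_mono)
    also have "\<dots> = 6 * ?K * norm v" by simp
    finally show "norm (?D w v) \<le> 6 * ?K * norm v"
      using norm_le_l1_cart order_trans by blast
  qed
  have "norm ((X \<circ> E) b - (X \<circ> E) a) \<le> 6 * ?K * norm (b - a)"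
    by (rule differentiable_bound[OF \<open>convex S\<close> has_derivative_at_withinI[OF der] bound]) (use assms in auto)
  then show ?thesis by (simp add: dist_norm norm_minus_commute)
qed

text \<open>The image of the straight segment is one competitor in the infimum, and its length is
  bounded by the Lipschitz constant.\<close>

lemma flat_map_induced_dist:
  assumes E: "flat_map S E" and S: "convex S" and ab: "a \<in> S" "b \<in> S"
  shows "induced_dist T X (E a) (E b) \<le> ereal (6 * (1 + 2 / \<epsilon>) * dist a b)"
proof -
  define l where "l t = a + t *\<^sub>R (b - a)" for t :: real
  have l: "l t \<in> S" if "0 \<le> t" "t \<le> 1" for t
  proof -
    have "l t = (1 - t) *\<^sub>R a + t *\<^sub>R b" by (simp add: l_def algebra_simps)
    then show ?thesis using convexD_alt[OF S ab that] by simp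
  qed
  have "continuous_map (top_of_set {0..1}) (top_of_set S) l"
    using l by (auto simp: l_def[abs_def] intro!: continuous_intros)
  then have "pathin T (E \<circ> l)"
    unfolding pathin_def by (rule continuous_map_compose[OF _ flat_map_continuous[OF E]])
  then have "induced_dist T X (E a) (E b) \<le> curve_length (X \<circ> (E \<circ> l))"
    by (rule induced_dist_le) (simp_all add: l_def)
  also have "\<dots> \<le> ereal (6 * (1 + 2 / \<epsilon>) * dist a b)"
  proof (rule curve_length_le)
    fix s t :: real assume st: "0 \<le> s" "s \<le> t" "t \<le> 1"
    have "l s - l t = (s - t) *\<^sub>R (b - a)" by (simp add: l_def algebra_simps)
    then have "dist (l s) (l t) = (t - s) * dist a b"
      using st by (simp add: dist_norm norm_minus_commute)
    then show "dist ((X \<circ> (E \<circ> l)) s) ((X \<circ> (E \<circ> l)) t) \<le> 6 * (1 + 2 / \<epsilon>) * dist a b * (t - s)"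
      using flat_map_lipschitz[OF E S l[of s] l[of t]] st by (simp add: mult_ac)
  qed
  finally show ?thesis .
qed

text \<open>Completeness enters here: a Cauchy sequence of points at which the existence radius degenerates would
  converge to a point violating local existence.\<close>

lemma flat_map_uniform_existence_radius:
  assumes complete: "complete_immersion T X" and E: "flat_map (ball 0 R) E"
  obtains \<delta> where "0 < \<delta>" "\<And>w. w \<in> ball 0 R \<Longrightarrow> \<exists>E'. flat_map (ball 0 \<delta>) E' \<and> E' 0 = E w"
proof -
  have "\<exists>\<delta>>0. \<forall>w\<in>ball 0 R. \<exists>E'. flat_map (ball 0 \<delta>) E' \<and> E' 0 = E w"
  proof (rule ccontr)
    assume "\<not> ?thesis"
    then have "\<exists>w\<in>ball 0 R. \<nexists>E'. flat_map (ball 0 (inverse (Suc n))) E' \<and> E' 0 = E w" for n :: nat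
      by (metis inverse_positive_iff_positive of_nat_0_less_iff zero_less_Suc)
    then obtain x where x: "\<And>n. x n \<in> ball 0 R"
      "\<And>n E'. \<not> (flat_map (ball 0 (inverse (Suc n))) E' \<and> E' 0 = E (x n))" by metis
    have "bounded (range x)" using x(1) by (intro bounded_subset[OF bounded_ball[of 0 R]]) auto
    then obtain l k where k: "strict_mono k" "(x \<circ> k) \<longlonglongrightarrow> l"
      using bounded_imp_convergent_subsequence by blast
    let ?K = "6 * (1 + 2 / \<epsilon>)"
    have K: "0 < ?K" using eps_pos by (simp add: add_pos_pos)
    \<comment> \<open>The limit \<open>l\<close> may lie on the boundary circle, where
      \<open>E\<close> is arbitrary. So just the Cauchy property is transferred, and completeness
      supplies a limit on the surface.\<close>
    have "\<exists>N. \<forall>m\<ge>N. \<forall>n\<ge>N. induced_dist T X (E (x (k m))) (E (x (k n))) < ereal e" if "0 < e" for e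
    proof -
      have "Cauchy (x \<circ> k)" using k(2) by (simp add: LIMSEQ_imp_Cauchy)
      moreover have "0 < e / ?K" using that K by simp
      ultimately obtain N where N: "\<And>m n. m \<ge> N \<Longrightarrow> n \<ge> N \<Longrightarrow> dist (x (k m)) (x (k n)) < e / ?K"
        unfolding Cauchy_def o_def by blast
      have "induced_dist T X (E (x (k m))) (E (x (k n))) < ereal e" if "m \<ge> N" "n \<ge> N" for m n
      proof -
        have "?K * dist (x (k m)) (x (k n)) < e" using N[OF that] K by (simp add: pos_less_divide_eq mult.commute)
        then show ?thesis
          using flat_map_induced_dist[OF E convex_ball x(1) x(1)] le_less_trans less_ereal.simps(1) by blast
      qed
      then show ?thesis by blast
    qed
    moreover have "\<forall>i. E (x (k i)) \<in> topspace T" using flat_mapD(2)[OF E] x(1) by blast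
    ultimately obtain p where p: "p \<in> topspace T" "limitin T (\<lambda>i. E (x (k i))) p sequentially"
      using complete[unfolded complete_immersion_def, rule_format, of "\<lambda>i. E (x (k i))"] by blast
    obtain \<delta> W where W: "0 < \<delta>" "openin T W" "p \<in> W"
      "\<And>q. q \<in> W \<Longrightarrow> \<exists>E. flat_map (ball 0 \<delta>) E \<and> E 0 = q"
      using flat_map_uniform_local_existence[OF p(1)] by metis
    obtain N where N: "\<And>n. N \<le> n \<Longrightarrow> E (x (k n)) \<in> W"
      using p(2) W(2,3) unfolding limitin_sequentially by blast
    obtain M where M: "inverse (Suc M) < \<delta>" using reals_Archimedean[OF W(1)] by blast
    define n where "n = max N M"
    \<comment> \<open>Far along the subsequence the excluded radius is below
      \<open>\<delta>\<close>, so the solution near \<open>p\<close> restricts to an excluded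
      one.\<close>
    have "M \<le> k n" using seq_suble[OF k(1), of n] by (simp add: n_def)
    then have "inverse (real (Suc (k n))) \<le> inverse (Suc M)" by (simp add: field_simps)
    then have sub: "ball 0 (inverse (real (Suc (k n)))) \<subseteq> ball (0 :: complex) \<delta>" using M by (intro subset_ball) linarith
    obtain E' where "flat_map (ball 0 \<delta>) E'" "E' 0 = E (x (k n))"
      using W(4)[OF N[of n]] by (auto simp: n_def)
    then show False using x(2)[of "k n" E'] flat_map_subset[OF _ open_ball sub] by blast
  qed
  then show ?thesis using that by blast
qed

section \<open>Continuation to the whole plane\<close>

text \<open>Discs of one radius \<open>\<delta>\<close> about all points of the old disc cover the
  larger disc, and the recentred solutions on them glue.\<close>

lemma flat_map_extend:
  assumes complete: "complete_immersion T X" and R: "0 < R" and E: "flat_map (ball 0 R) E"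
  obtains \<delta> E' where "0 < \<delta>" "flat_map (ball 0 (R + \<delta>)) E'" "E' 0 = E 0"
proof -
  obtain \<delta> where \<delta>: "0 < \<delta>"
    "\<And>w. w \<in> ball 0 R \<Longrightarrow> \<exists>E'. flat_map (ball 0 \<delta>) E' \<and> E' 0 = E w"
    using flat_map_uniform_existence_radius[OF complete E] by metis
  then obtain G where G: "\<And>w. w \<in> ball 0 R \<Longrightarrow> flat_map (ball 0 \<delta>) (G w)"
    "\<And>w. w \<in> ball 0 R \<Longrightarrow> G w 0 = E w" by metis
  define H where "H a z = G a (z - a)" for a z
  have H: "flat_map (ball a \<delta>) (H a)" "H a a = E a" if "a \<in> ball 0 R" for a
  proof -
    have "{w. w + - a \<in> ball 0 \<delta>} = ball a \<delta>" by (auto simp: dist_norm norm_minus_commute)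
    then show "flat_map (ball a \<delta>) (H a)"
      using flat_map_shift[OF G(1)[OF that], of "- a"] by (simp add: H_def[abs_def])
    show "H a a = E a" using G(2)[OF that] by (simp add: H_def)
  qed
  have HE: "H a z = E z" if a: "a \<in> ball 0 R" and z: "z \<in> ball 0 R \<inter> ball a \<delta>" for a z
  proof -
    have 1: "flat_map (ball 0 R \<inter> ball a \<delta>) (H a)"
      by (rule flat_map_subset[OF H(1)[OF a]]) auto
    have 2: "flat_map (ball 0 R \<inter> ball a \<delta>) E"
      by (rule flat_map_subset[OF E]) auto
    have "connected (ball 0 R \<inter> ball a \<delta>)" by (intro convex_connected convex_Int convex_ball)
    from flat_map_unique[OF 1 2 this _ H(2)[OF a] z] show ?thesis using a \<delta>(1) by simp
  qed
  text \<open>The discs overlap in a convex set containing the midpoint of their centres, where both maps agree with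
    the given one.\<close>
  have HH: "H a z = H b z" if a: "a \<in> ball 0 R" and b: "b \<in> ball 0 R" and z: "z \<in> ball a \<delta> \<inter> ball b \<delta>" for a b z
  proof -
    let ?m = "midpoint a b"
    have 1: "flat_map (ball a \<delta> \<inter> ball b \<delta>) (H a)"
      by (rule flat_map_subset[OF H(1)[OF a]]) auto
    have 2: "flat_map (ball a \<delta> \<inter> ball b \<delta>) (H b)"
      by (rule flat_map_subset[OF H(1)[OF b]]) auto
    have "dist a b < 2 * \<delta>" using z dist_triangle_less_add[of a z \<delta> b \<delta>] by (simp add: dist_commute)
    then have m: "?m \<in> ball a \<delta> \<inter> ball b \<delta>" by (simp add: dist_midpoint)
    have mR: "?m \<in> ball 0 R"
      using a b norm_triangle_ineq[of a b] by (simp add: midpoint_def)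
    have "connected (ball a \<delta> \<inter> ball b \<delta>)" by (intro convex_connected convex_Int convex_ball)
    moreover have "H a ?m = H b ?m" using HE[OF a] HE[OF b] m mR by simp
    ultimately show ?thesis using flat_map_unique[OF 1 2 _ m _ z] by blast
  qed
  have near: "\<exists>a\<in>ball 0 R. z \<in> ball a \<delta>" if z: "z \<in> ball 0 (R + \<delta>)" for z :: complex
  proof (cases "norm z < R")
    case True
    then show ?thesis using \<delta>(1) by (intro bexI[of _ z]) auto
  next
    case False
    then have nz: "0 < norm z" "R \<le> norm z" using R by auto
    \<comment> \<open>The centre is taken on the ray of \<open>z\<close>. Moving in from radius
      \<open>R\<close> by half of the slack \<open>R + \<delta> - norm z\<close> keeps the distance
      below \<open>\<delta>\<close>; the maximum with \<open>R / 2\<close> keeps \<open>s\<close>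
      positive.\<close>
    define s where "s = max (R / 2) (R - (R + \<delta> - norm z) / 2)"
    have s: "0 < s" "s < R" "norm z - s < \<delta>" using R z by (auto simp: s_def max_def field_simps)
    define a where "a = (s / norm z) *\<^sub>R z"
    have "norm a = s" using s nz by (simp add: a_def)
    moreover have "z - a = ((norm z - s) / norm z) *\<^sub>R z" using nz by (simp add: a_def diff_divide_distrib algebra_simps)
    then have "norm (z - a) = norm z - s" using s nz by simp
    ultimately show ?thesis using s by (intro bexI[of _ a]) (auto simp: dist_norm norm_minus_commute)
  qed
  then obtain c :: "complex \<Rightarrow> complex" where c: "\<And>z. z \<in> ball 0 (R + \<delta>) \<Longrightarrow> c z \<in> ball 0 R"
    "\<And>z. z \<in> ball 0 (R + \<delta>) \<Longrightarrow> z \<in> ball (c z) \<delta>" by metis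
  \<comment> \<open>The centres are chosen arbitrarily, without continuity in \<open>z\<close>; by
    \<open>HH\<close> the value is the same for every admissible centre.\<close>
  define E' where "E' z = H (c z) z" for z
  have "flat_map (ball 0 (R + \<delta>)) E'"
  proof (rule flat_map_locally)
    fix w :: complex assume w: "w \<in> ball 0 (R + \<delta>)"
    let ?N = "ball (c w) \<delta> \<inter> ball 0 (R + \<delta>)"
    have "flat_map ?N (H (c w))" by (rule flat_map_subset[OF H(1)[OF c(1)[OF w]]]) auto
    moreover have "\<forall>z\<in>?N. E' z = H (c w) z"
      unfolding E'_def using HH c w by blast
    ultimately show "\<exists>N E''. w \<in> N \<and> N \<subseteq> ball 0 (R + \<delta>) \<and> (\<forall>z\<in>N. E' z = E'' z) \<and> flat_map N E''"
      using w c(2) by (intro exI[of _ ?N] exI[of _ "H (c w)"]) auto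
  qed
  moreover have "E' 0 = E 0"
    unfolding E'_def by (rule HE) (use c[of 0] R \<delta>(1) in auto)
  ultimately show ?thesis using that \<delta>(1) by blast
qed

text \<open>Two concentric discs are nested and their solutions agree at 0, hence on the smaller
  disc. Applied to discs below a radius and to all discs of the plane.\<close>

lemma flat_map_exhaust:
  assumes S: "0 \<in> S"
    and ex: "\<And>w. w \<in> S \<Longrightarrow> \<exists>r E. norm w < r \<and> ball 0 r \<subseteq> S \<and> flat_map (ball 0 r) E \<and> E 0 = p"
  obtains E where "flat_map S E" "E 0 = p"
proof -
  from ex obtain r G where r: "\<And>w. w \<in> S \<Longrightarrow> norm w < r w" "\<And>w. w \<in> S \<Longrightarrow> ball 0 (r w) \<subseteq> S"
    "\<And>w. w \<in> S \<Longrightarrow> flat_map (ball 0 (r w)) (G w)" "\<And>w. w \<in> S \<Longrightarrow> G w 0 = p" by metis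
  define E where "E w = G w w" for w
  have eq: "G z z = G w z" if wz: "w \<in> S" "z \<in> S" "norm z < r w" for w z
  proof -
    let ?B = "ball (0 :: complex) (min (r w) (r z))"
    have 1: "flat_map ?B (G z)" by (rule flat_map_subset[OF r(3)[OF wz(2)]]) auto
    have 2: "flat_map ?B (G w)" by (rule flat_map_subset[OF r(3)[OF wz(1)]]) auto
    have z: "z \<in> ?B" using wz(3) r(1)[OF wz(2)] by auto
    have "0 \<le> norm z" by simp
    then have "0 \<in> ?B" using z by (simp del: norm_ge_zero)
    then show ?thesis
      using flat_map_unique[OF 1 2 connected_ball, of 0 z] z r(4)[OF wz(1)] r(4)[OF wz(2)] by simp
  qed
  have "flat_map S E"
  proof (rule flat_map_locally)
    fix w assume w: "w \<in> S"
    show "\<exists>N E'. w \<in> N \<and> N \<subseteq> S \<and> (\<forall>z\<in>N. E z = E' z) \<and> flat_map N E'"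
      using r[OF w] eq[OF w] by (intro exI[of _ "ball 0 (r w)"] exI[of _ "G w"]) (auto simp: E_def)
  qed
  moreover have "E 0 = p" using r(4)[OF S] by (simp add: E_def)
  ultimately show ?thesis using that by blast
qed

text \<open>If some radius failed, the supremum of the admissible radii would be admissible by
  exhaustion and then exceeded by extension.\<close>

lemma flat_map_global_existence:
  assumes complete: "complete_immersion T X" and p: "p \<in> topspace T"
  obtains E where "flat_map UNIV E" "E 0 = p"
proof -
  define Q where "Q r \<longleftrightarrow> (\<exists>E. flat_map (ball 0 r) E \<and> E 0 = p)" for r
  have Q_mono: "Q s" if "Q r" "s \<le> r" for r s
    using that flat_map_subset subset_ball[OF that(2)] unfolding Q_def by blast
  have "Q r" for r
  proof (rule ccontr)
    assume nQ: "\<not> Q r"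
    define G where "G = {s. Q s}"
    obtain d where d: "0 < d" "Q d"
      using flat_map_local_existence[OF p] unfolding Q_def by metis
    have ub: "s \<le> r" if "s \<in> G" for s using Q_mono[of s r] that nQ by (force simp: G_def)
    then have bdd: "bdd_above G" by (meson bdd_aboveI)
    define R where "R = Sup G"
    have "d \<le> R" unfolding R_def by (rule cSup_upper[OF _ bdd]) (simp add: G_def d)
    then have R: "0 < R" using d by simp
    have "Q s" if "s < R" for s
    proof -
      have "\<exists>t\<in>G. s < t"
        using that less_cSup_iff[of G s] d(2) bdd by (auto simp: R_def G_def)
      then show ?thesis using Q_mono[of _ s] by (auto simp: G_def)
    qed
    then have "\<exists>t E. norm w < t \<and> ball 0 t \<subseteq> ball 0 R \<and> flat_map (ball 0 t) E \<and> E 0 = p"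
      if "w \<in> ball 0 R" for w :: complex
      using that dense[of "norm w" R] subset_ball[of _ R 0] unfolding Q_def
      by (metis less_imp_le mem_ball_0)
    then obtain E where E: "flat_map (ball 0 R) E" "E 0 = p"
      using flat_map_exhaust[of "ball 0 R" p] R by auto
    obtain \<delta> where "0 < \<delta>" "Q (R + \<delta>)"
      using flat_map_extend[OF complete R E(1)] E(2) unfolding Q_def by metis
    then have "R + \<delta> \<le> R" unfolding R_def by (intro cSup_upper bdd) (auto simp: G_def R_def)
    then show False using \<open>0 < \<delta>\<close> by simp
  qed
  then have "\<exists>r E. norm w < r \<and> ball 0 r \<subseteq> UNIV \<and> flat_map (ball 0 r) E \<and> E 0 = p" for w :: complex
    unfolding Q_def by (metis gt_ex subset_UNIV)
  then show ?thesis using flat_map_exhaust[of UNIV p] that by auto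
qed

text \<open>Two global solutions whose images meet are translates of each other. Hence their images
  are equal or disjoint, and since these are open, the complement of one image is a union of open
  sets; connectedness concludes.\<close>

lemma flat_map_UNIV_surj:
  assumes complete: "complete_immersion T X" and E: "flat_map UNIV E"
  shows "range E = topspace T"
proof -
  have sub: "range E \<subseteq> topspace T" using flat_mapD(2)[OF E] by auto
  have "openin T (topspace T - range E)"
  proof (subst openin_subopen, intro ballI)
    fix q assume q: "q \<in> topspace T - range E"
    then obtain G where G: "flat_map UNIV G" "G 0 = q"
      using flat_map_global_existence[OF complete] by auto
    have "G u \<noteq> E w" for u w
    proof
      assume eq: "G u = E w"
      have "flat_map UNIV (\<lambda>v. E (v + (w - u)))" using flat_map_shift[OF E, of "w - u"] by simp
      from flat_map_unique[OF G(1) this connected_UNIV, of u 0] eq G(2)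
      have "q = E (w - u)" by simp
      then show False using q by blast
    qed
    then have "range G \<subseteq> topspace T - range E" using flat_mapD(2)[OF G(1)] by auto
    then show "\<exists>V. openin T V \<and> q \<in> V \<and> V \<subseteq> topspace T - range E"
      using flat_map_image_open[OF G(1)] G(2) by blast
  qed
  then have "closedin T (range E)" using sub by (simp add: closedin_def)
  moreover have "openin T (range E)" by (rule flat_map_image_open[OF E])
  moreover have "connected_space T" using surface by (simp add: riemann_surface_def)
  ultimately show ?thesis unfolding connected_space_clopen_in by blast
qed

section \<open>Liouville's theorem and the affine image\<close>

lemma flat_map_UNIV_plane:
  assumes E: "flat_map UNIV E"
  shows "is_plane (range (X \<circ> E))"
proof -
  let ?Y = "X \<circ> E"
  have "phi_comp ?Y j constant_on UNIV" for j
  proof (rule Liouville_theorem[OF flat_map_phi_comp_holomorphic[OF E]])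
    show "bounded (range (phi_comp ?Y j))"
      using flat_map_phi_comp_bound[OF E, of _ j] unfolding bounded_iff by blast
  qed
  then obtain c where c: "\<And>j w. phi_comp ?Y j w = c j"
    unfolding constant_on_def by (metis UNIV_I)
  have Y: "?Y w $ j = ?Y 0 $ j + 2 * Re (c j * w)" for w j
  proof -
    have "((\<lambda>w. ?Y w $ j - 2 * Re (c j * w)) has_derivative (\<lambda>_. 0)) (at w within UNIV)" for w
    proof -
      obtain D where D: "(?Y has_derivative D) (at w)"
        using flat_map_differentiable[OF E UNIV_I] by (auto simp: differentiable_def)
      have 1: "((\<lambda>w. ?Y w $ j) has_derivative (\<lambda>v. D v $ j)) (at w)"
        by (rule bounded_linear.has_derivative[OF bounded_linear_vec_nth D])
      have 2: "((\<lambda>w. 2 * Re (c j * w)) has_derivative (\<lambda>v. 2 * Re (c j * v))) (at w)"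
        by (intro has_derivative_mult_right has_derivative_Re has_derivative_ident)
      show ?thesis
        using has_derivative_diff[OF 1 2] by (simp only: has_derivative_nth_eq_phi_comp[OF D] c diff_self)
    qed
    from has_derivative_zero_unique[OF convex_UNIV this UNIV_I UNIV_I, of w 0] show ?thesis by simp
  qed
  have "?Y = (\<lambda>w. ?Y 0 + (\<chi> j. 2 * Re (c j * w)))"
    unfolding fun_eq_iff vec_eq_iff vector_add_component vec_lambda_beta by (intro allI) (rule Y)
  \<comment> \<open>Positivity at any single parameter excludes an image that degenerates to a line
    or a point.\<close>
  moreover have "0 < Im (c 1 * cnj (c 2))"
    using flat_map_jacobian_pos[OF E UNIV_I] unfolding c .
  ultimately show ?thesis using is_plane_affine_image by metis
qed

end

theorem theorem6p1:
  fixes T :: "'a topology" and A :: "('a set \<times> ('a \<Rightarrow> complex)) set"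
    and X :: "'a \<Rightarrow> real^3" and \<epsilon> :: real
  assumes "open_riemann_surface T A"
    and "harmonic_immersion T A X"
    and "complete_immersion T X"
    and "\<epsilon> > 0"
    and "gaussian_image A X \<subseteq> sphere 0 1 \<inter> {x. x $ 3 > \<epsilon>}"
  shows "is_plane (X ` topspace T)"
proof -
  interpret tilted_immersion T A X \<epsilon>
    using assms by unfold_locales (auto simp: open_riemann_surface_def)
  obtain p where "p \<in> topspace T" using surface unfolding riemann_surface_def by blast
  then obtain E where E: "flat_map UNIV E"
    using flat_map_global_existence[OF assms(3)] by blast
  have "X ` topspace T = range (X \<circ> E)"
    by (simp add: image_comp flip: flat_map_UNIV_surj[OF assms(3) E])
  then show ?thesis using flat_map_UNIV_plane[OF E] by simp
qed

end
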